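(* Assume $-\frac{\pi}{2}<\theta<\frac{\pi}{2}$, $\alpha>0$ and $\gamma>0$. Let $u_0\in H^1(\mathbb{R}^N)\cap C_0(\mathbb{R}^N)$ and let $u\in C([0,T_{\max}),H^1(\mathbb{R}^N)\cap C_0(\mathbb{R}^N))$ be the corresponding maximal solution of $$u_t=e^{i\theta}\left[\Delta u+|u|^\alpha u\right]+\gamma u,\qquad u(0)=u_0,$$ in $\mathbb{R}^N$. If $E(u_0)<0$, where $$E(w)=\frac12\int_{\mathbb{R}^N}|\nabla w|^2-\frac{1}{\alpha+2}\int_{\mathbb{R}^N}|w|^{\alpha+2},$$ then $u$ blows up in finite time, i.e., $T_{\max}<\infty$.
   Context: $N\ge 1$ is an integer; functions are complex-valued. $C_0(\mathbb{R}^N)$ is the space of continuous functions $\mathbb{R}^N\to\mathbb{C}$ vanishing at infinity, with the sup norm; $H^1(\mathbb{R}^N)\cap C_0(\mathbb{R}^N)$ carries the natural intersection topology. Maximal solution: for $-\frac{\pi}{2}<\theta<\frac{\pi}{2}$, $\alpha>0$, $\gamma\in\mathbb{R}$, the Cauchy problem is locally well-posed in $H^1(\mathbb{R}^N)\cap C_0(\mathbb{R}^N)$. For every $u_0$ in this space there is a unique solution $u$, defined on a maximal interval $[0,T_{\max})$ with $0<T_{\max}\le\infty$, such that $u\in C([0,T_{\max}),C_0(\mathbb{R}^N)\cap H^1(\mathbb{R}^N))\cap C((0,T_{\max}),H^2(\mathbb{R}^N))\cap C^1((0,T_{\max}),L^2(\mathbb{R}^N))$, $u$ satisfies the equation for all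 $t\in(0,T_{\max})$, and $u(0)=u_0$. If $T_{\max}<\infty$, then $\|u(t)\|_{L^\infty}\to\infty$ as $t\uparrow T_{\max}$. *)

theory Defs
  imports "HOL-Analysis.Analysis"
begin

text \<open>
  Elements of the function spaces below are actual functions, not equivalence classes modulo null
  sets; \<open>L2\<close> consists of Borel representatives. Hence the differential equation and the
  time derivative, which live in \<open>L2\<close>, are understood almost everywhere in space.
\<close>

section \<open>Function spaces\<close>

definition C0 :: "('a::euclidean_space \<Rightarrow> complex) set" where
  "C0 = {f. continuous_on UNIV f \<and> (f \<longlongrightarrow> 0) at_infinity}"

definition sup_norm :: "('a::euclidean_space \<Rightarrow> complex) \<Rightarrow> real" where
  "sup_norm f = (SUP x. norm (f x))"

definition L2 :: "('a::euclidean_space \<Rightarrow> complex) set" where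
  "L2 = {f \<in> borel_measurable lborel. integrable lborel (\<lambda>x. (norm (f x))\<^sup>2)}"

definition L2_norm :: "('a::euclidean_space \<Rightarrow> complex) \<Rightarrow> real" where
  "L2_norm f = sqrt (\<integral>x. (norm (f x))\<^sup>2 \<partial>lborel)"

primrec C_k :: "nat \<Rightarrow> ('a::euclidean_space \<Rightarrow> real) \<Rightarrow> bool" where
  "C_k 0 \<phi> \<longleftrightarrow> continuous_on UNIV \<phi>"
| "C_k (Suc k) \<phi> \<longleftrightarrow>
     (\<forall>x. \<phi> differentiable (at x)) \<and> (\<forall>v. C_k k (\<lambda>x. frechet_derivative \<phi> (at x) v))"

definition test_functions :: "('a::euclidean_space \<Rightarrow> real) set" where
  "test_functions = {\<phi>. (\<forall>k. C_k k \<phi>) \<and> compact (closure {x. \<phi> x \<noteq> 0})}"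

definition locally_integrable :: "('a::euclidean_space \<Rightarrow> complex) \<Rightarrow> bool" where
  "locally_integrable f \<longleftrightarrow> (\<forall>K. compact K \<longrightarrow> set_integrable lborel K f)"

definition has_weak_deriv ::
    "'a::euclidean_space \<Rightarrow> ('a \<Rightarrow> complex) \<Rightarrow> ('a \<Rightarrow> complex) \<Rightarrow> bool" where
  "has_weak_deriv b f g \<longleftrightarrow> locally_integrable f \<and> locally_integrable g \<and>
     (\<forall>\<phi>\<in>test_functions.
        (\<integral>x. frechet_derivative \<phi> (at x) b *\<^sub>R f x \<partial>lborel) = - (\<integral>x. \<phi> x *\<^sub>R g x \<partial>lborel))"

text \<open>
  Weak derivatives are unique up to null sets, and everything below depends on the chosen
  representative only up to null sets.
\<close>

definition weak_deriv :: "'a::euclidean_space \<Rightarrow> ('a \<Rightarrow> complex) \<Rightarrow> 'a \<Rightarrow> complex" where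
  "weak_deriv b f = (SOME g. has_weak_deriv b f g)"

definition H1 :: "('a::euclidean_space \<Rightarrow> complex) set" where
  "H1 = {f \<in> L2. \<forall>b\<in>Basis. \<exists>g\<in>L2. has_weak_deriv b f g}"

definition H1_norm :: "('a::euclidean_space \<Rightarrow> complex) \<Rightarrow> real" where
  "H1_norm f = sqrt ((L2_norm f)\<^sup>2 + (\<Sum>b\<in>Basis. (L2_norm (weak_deriv b f))\<^sup>2))"

definition H2 :: "('a::euclidean_space \<Rightarrow> complex) set" where
  "H2 = {f \<in> H1. \<forall>b\<in>Basis. weak_deriv b f \<in> H1}"

definition H2_norm :: "('a::euclidean_space \<Rightarrow> complex) \<Rightarrow> real" where
  "H2_norm f = sqrt ((L2_norm f)\<^sup>2 + (\<Sum>b\<in>Basis. (H1_norm (weak_deriv b f))\<^sup>2))"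

definition laplacian :: "('a::euclidean_space \<Rightarrow> complex) \<Rightarrow> 'a \<Rightarrow> complex" where
  "laplacian f x = (\<Sum>b\<in>Basis. weak_deriv b (weak_deriv b f) x)"

section \<open>Curves in function spaces\<close>

text \<open>\<open>u \<in> C(I, X)\<close> for a space \<open>X\<close> with norm \<open>nrm\<close>; nothing is said about \<open>u\<close> outside \<open>I\<close>.\<close>

definition continuous_curve :: "real set \<Rightarrow> ('a \<Rightarrow> complex) set \<Rightarrow> (('a \<Rightarrow> complex) \<Rightarrow> real)
    \<Rightarrow> (real \<Rightarrow> 'a \<Rightarrow> complex) \<Rightarrow> bool" where
  "continuous_curve I X nrm u \<longleftrightarrow>
     (\<forall>t\<in>I. u t \<in> X \<and> ((\<lambda>s. nrm (\<lambda>x. u s x - u t x)) \<longlongrightarrow> 0) (at t within I))"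

definition has_L2_time_deriv ::
    "(real \<Rightarrow> 'a::euclidean_space \<Rightarrow> complex) \<Rightarrow> ('a \<Rightarrow> complex) \<Rightarrow> real \<Rightarrow> bool" where
  "has_L2_time_deriv u v t \<longleftrightarrow> v \<in> L2 \<and>
     ((\<lambda>h. L2_norm (\<lambda>x. (u (t + h) x - u t x) /\<^sub>R h - v x)) \<longlongrightarrow> 0) (at 0)"

section \<open>The Cauchy problem and the energy\<close>

text \<open>
  \<open>u\<close> is a solution on \<open>[0, T)\<close>, \<open>0 < T \<le> \<infinity>\<close>. The sum of the two norms induces the intersection
  topology on \<open>H1 \<inter> C0\<close>; \<open>ut\<close> is the time derivative witnessing
  \<open>u \<in> C\<^sup>1((0, T), L2)\<close>.
\<close>

definition is_solution :: "real \<Rightarrow> real \<Rightarrow> real \<Rightarrow> ('a::euclidean_space \<Rightarrow> complex) \<Rightarrow> ereal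
    \<Rightarrow> (real \<Rightarrow> 'a \<Rightarrow> complex) \<Rightarrow> bool" where
  "is_solution \<theta> \<alpha> \<gamma> u0 T u \<longleftrightarrow>
     0 < T \<and> u 0 = u0 \<and>
     continuous_curve {t. 0 \<le> t \<and> ereal t < T} (H1 \<inter> C0) (\<lambda>f. H1_norm f + sup_norm f) u \<and>
     continuous_curve {t. 0 < t \<and> ereal t < T} H2 H2_norm u \<and>
     (\<exists>ut. continuous_curve {t. 0 < t \<and> ereal t < T} L2 L2_norm ut \<and>
        (\<forall>t. 0 < t \<and> ereal t < T \<longrightarrow>
           has_L2_time_deriv u (ut t) t \<and>
           (AE x in lborel. ut t x =
              cis \<theta> * (laplacian (u t) x + of_real (norm (u t x) powr \<alpha>) * u t x)
              + of_real \<gamma> * u t x)))"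

definition is_maximal_solution :: "real \<Rightarrow> real \<Rightarrow> real \<Rightarrow> ('a::euclidean_space \<Rightarrow> complex) \<Rightarrow> ereal
    \<Rightarrow> (real \<Rightarrow> 'a \<Rightarrow> complex) \<Rightarrow> bool" where
  "is_maximal_solution \<theta> \<alpha> \<gamma> u0 T u \<longleftrightarrow>
     is_solution \<theta> \<alpha> \<gamma> u0 T u \<and>
     (\<forall>S v. is_solution \<theta> \<alpha> \<gamma> u0 S v \<and> (\<forall>t. 0 \<le> t \<and> ereal t < T \<longrightarrow> v t = u t) \<longrightarrow> S \<le> T)"

definition energy :: "real \<Rightarrow> ('a::euclidean_space \<Rightarrow> complex) \<Rightarrow> real" where
  "energy \<alpha> w = 1 / 2 * (\<integral>x. (\<Sum>b\<in>Basis. (norm (weak_deriv b w x))\<^sup>2) \<partial>lborel)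
     - 1 / (\<alpha> + 2) * (\<integral>x. norm (w x) powr (\<alpha> + 2) \<partial>lborel)"

end

theory Submission
  imports Defs
begin

text \<open>
  Suppose that the solution is global. Let \<open>M\<close> be the square of the
  \<open>L2\<close> norm of \<open>u\<close>, \<open>E\<close> its energy, \<open>w = \<Delta>u
  + |u|\<^sup>\<alpha> u\<close>, and let \<open>J\<close> be the integral of \<open>|u| powr
  (\<alpha> + 2) - |\<nabla>u|\<^sup>2\<close>. Integration by parts shows that the Hermitian
  product of \<open>w\<close> with \<open>u\<close> is the real number \<open>J\<close>. Pairing
  the equation \<open>u\<^sub>t = cis \<theta> w + \<gamma> u\<close> with \<open>u\<close> and
  with \<open>w\<close>, which is minus the gradient of \<open>E\<close>, gives \<open>M' = 2
  cos \<theta> J + 2 \<gamma> M\<close> and \<open>E' = - cos \<theta>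
  \<parallel>w\<parallel>\<^sup>2 - \<gamma> J\<close>.

  The weighted quantities \<open>m = exp (-2\<gamma>t) M\<close> and \<open>g = - exp
  (-2\<gamma>t) E\<close> behave as in the case \<open>\<gamma> = 0\<close>. Since \<open>J
  \<ge> - (\<alpha> + 2) E\<close>, one has \<open>m' \<ge> 2 cos \<theta> (\<alpha> + 2)
  g\<close>. Since \<open>2 E + J \<ge> 0\<close>, \<open>g' \<ge> exp (-2\<gamma>t) cos
  \<theta> \<parallel>w\<parallel>\<^sup>2 \<ge> 0\<close>, so that \<open>g\<close> stays
  positive if \<open>E (u 0) < 0\<close>. The Cauchy-Schwarz inequality \<open>J\<^sup>2 \<le>
  \<parallel>w\<parallel>\<^sup>2 M\<close> yields \<open>m g' \<ge> (\<alpha>/2 + 1) m'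
  g\<close>; no factor \<open>cos \<theta>\<close> is lost here because \<open>J\<close> is the
  full complex pairing of \<open>w\<close> with \<open>u\<close>. Therefore \<open>g\<close>
  dominates a multiple of \<open>m powr (\<alpha>/2 + 1)\<close>, and \<open>m\<close> satisfies
  a superlinear differential inequality, which cannot hold for all time
  (\<open>concavity_method\<close>).

  Making the two identities rigorous takes three analytic ingredients. Weak derivatives are
  unique up to null sets (\<open>fundamental_lemma\<close>,
  \<open>has_weak_deriv_unique\<close>), so that the chosen representatives depend linearly on
  the function. Integration by parts holds in \<open>H1\<close>
  (\<open>integration_by_parts\<close>); it follows from translation invariance of the Lebesgue
  measure and the formula \<open>f (x + h v) - f x = \<integral> s \<in> {0..h}.
  \<partial>\<^sub>v f (x + s v)\<close>. Finally, the energy is differentiable along a curve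
  that is differentiable only in \<open>L2\<close> (\<open>L2_time_chain_rule\<close>): the
  Dirichlet integral has increment \<open>- L2_inner (\<Delta>f + \<Delta>g) (f - g)\<close>,
  and the potential has a remainder that is quadratic in \<open>L2\<close> as long as the
  functions stay bounded (\<open>potential_quadratic_remainder\<close>).
\<close>

section \<open>Smooth bump functions and the fundamental lemma\<close>

text \<open>
  The functions \<open>bump_profile n\<close> extend \<open>exp (-1/t) / t^n\<close> by
  \<open>0\<close> to \<open>t \<le> 0\<close>. Differentiation maps each of them to a linear
  combination of two others, so the family is closed under differentiation and all its members
  are smooth.
\<close>

definition bump_profile :: "nat \<Rightarrow> real \<Rightarrow> real" where
  "bump_profile n t = (if t > 0 then inverse t ^ n * exp (- inverse t) else 0)"

lemma bump_profile_tendsto_0: "(bump_profile n \<longlongrightarrow> 0) (at 0)"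
proof -
  have "((\<lambda>t::real. inverse t ^ n / exp (inverse t)) \<longlongrightarrow> 0) (at_right 0)"
    using filterlim_compose[OF tendsto_power_div_exp_0 filterlim_inverse_at_top_right] .
  moreover have "\<forall>\<^sub>F t in at_right 0. inverse t ^ n / exp (inverse t) = bump_profile n t"
    unfolding eventually_at_filter by (auto simp: bump_profile_def exp_minus field_simps)
  ultimately have r: "(bump_profile n \<longlongrightarrow> 0) (at_right 0)"
    by (rule Lim_transform_eventually)
  have "\<forall>\<^sub>F t in at_left 0. 0 = bump_profile n t"
    unfolding eventually_at_filter by (auto simp: bump_profile_def)
  then have "(bump_profile n \<longlongrightarrow> 0) (at_left 0)"
    by (rule Lim_transform_eventually[OF tendsto_const])
  with r show ?thesis by (simp add: filterlim_split_at)
qed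

lemma bump_profile_deriv:
  "(bump_profile n has_real_derivative bump_profile (n + 2) t - of_nat n * bump_profile (n + 1) t) (at t)"
proof (cases t "0::real" rule: linorder_cases)
  case less
  have "((\<lambda>_. 0) has_real_derivative 0) (at t)" by simp
  then have "(bump_profile n has_real_derivative 0) (at t)"
    by (rule has_field_derivative_transform_within_open[where S="{..<0}"])
       (use less in \<open>auto simp: bump_profile_def\<close>)
  then show ?thesis using less by (simp add: bump_profile_def)
next
  case equal
  have "(bump_profile (n + 1) \<longlongrightarrow> 0) (at 0)" by (rule bump_profile_tendsto_0)
  moreover have "bump_profile (n + 1) = (\<lambda>s. (bump_profile n s - bump_profile n 0) / (s - 0))"
    by (auto simp: bump_profile_def field_simps)
  ultimately have "(bump_profile n has_real_derivative 0) (at 0)"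
    unfolding has_field_derivative_iff by simp
  then show ?thesis using equal by (simp add: bump_profile_def)
next
  case greater
  have "((\<lambda>t. inverse t ^ n * exp (- inverse t)) has_real_derivative
      bump_profile (n + 2) t - of_nat n * bump_profile (n + 1) t) (at t)"
    using greater
    by (auto intro!: derivative_eq_intros simp: bump_profile_def)
       (cases n; simp add: field_simps power2_eq_square)
  then show ?thesis
    by (rule has_field_derivative_transform_within_open[where S="{0<..}"])
       (use greater in \<open>auto simp: bump_profile_def\<close>)
qed

lemma C_k_const: "C_k k (\<lambda>x::'a::euclidean_space. c)"
  by (induction k arbitrary: c) auto

lemma C_k_Suc_imp: "C_k (Suc k) f \<Longrightarrow> C_k k f"
proof (induction k arbitrary: f)
  case 0
  then show ?case
    by (auto intro!: differentiable_imp_continuous_on simp: differentiable_on_def)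
next
  case (Suc k)
  then show ?case by (meson C_k.simps(2))
qed

lemma C_k_SucI:
  assumes "\<And>x. (f has_derivative f' x) (at x)" and "\<And>v. C_k k (\<lambda>x. f' x v)"
  shows "C_k (Suc k) f"
proof -
  have "frechet_derivative f (at x) = f' x" for x
    using assms(1) by (metis frechet_derivative_at)
  then show ?thesis using assms by (auto simp: differentiable_def)
qed

lemma C_k_SucD:
  assumes "C_k (Suc k) f"
  shows "(f has_derivative frechet_derivative f (at x)) (at x)"
  using assms by (simp add: frechet_derivative_works)

lemma C_k_add: "C_k k f \<Longrightarrow> C_k k g \<Longrightarrow> C_k k (\<lambda>x. f x + g x)"
proof (induction k arbitrary: f g)
  case (Suc k)
  show ?case
    by (rule C_k_SucI) (use Suc in \<open>auto intro!: has_derivative_add C_k_SucD[OF Suc.prems(1)] C_k_SucD[OF Suc.prems(2)]\<close>)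
qed (auto intro: continuous_intros)

lemma C_k_mult: "C_k k f \<Longrightarrow> C_k k g \<Longrightarrow> C_k k (\<lambda>x. f x * g x)"
proof (induction k arbitrary: f g)
  case (Suc k)
  show ?case
  proof (rule C_k_SucI)
    show "((\<lambda>x. f x * g x) has_derivative
        (\<lambda>v. f x * frechet_derivative g (at x) v + frechet_derivative f (at x) v * g x)) (at x)" for x
      by (intro has_derivative_mult C_k_SucD[OF Suc.prems(1)] C_k_SucD[OF Suc.prems(2)])
    show "C_k k (\<lambda>x. f x * frechet_derivative g (at x) v + frechet_derivative f (at x) v * g x)" for v
      using Suc.prems by (intro C_k_add Suc.IH C_k_Suc_imp[of k f] C_k_Suc_imp[of k g]) auto
  qed
qed (auto intro: continuous_intros)

lemma C_k_prod:
  assumes "finite A" and "\<And>i. i \<in> A \<Longrightarrow> C_k k (f i)"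
  shows "C_k k (\<lambda>x. \<Prod>i\<in>A. f i x)"
  using assms by (induction A) (auto intro!: C_k_mult C_k_const)

lemma C_k_bump_profile: "C_k k (\<lambda>x::'a::euclidean_space. bump_profile n (x \<bullet> w + d))"
proof (induction k arbitrary: n)
  case 0
  have "continuous_on UNIV (bump_profile n)"
    by (meson bump_profile_deriv DERIV_isCont continuous_at_imp_continuous_on)
  then show ?case
    by (auto intro!: continuous_on_compose2[of UNIV "bump_profile n"] continuous_intros)
next
  case (Suc k)
  show ?case
  proof (rule C_k_SucI)
    show "((\<lambda>x. bump_profile n (x \<bullet> w + d)) has_derivative
       (\<lambda>v. (v \<bullet> w) * (bump_profile (n + 2) (x \<bullet> w + d) + - of_nat n * bump_profile (n + 1) (x \<bullet> w + d)))) (at x)" for x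
      by (rule has_derivative_eq_rhs[OF
            has_derivative_compose[OF _ bump_profile_deriv[unfolded has_field_derivative_def]]])
         (auto intro!: derivative_eq_intros)
    show "C_k k (\<lambda>x. (v \<bullet> w) * (bump_profile (n + 2) (x \<bullet> w + d) + - of_nat n * bump_profile (n + 1) (x \<bullet> w + d)))" for v
      by (intro C_k_mult C_k_add C_k_const Suc.IH)
  qed
qed

text \<open>
  A smooth function supported in the box between \<open>a\<close> and \<open>c\<close>: in each
  coordinate, \<open>exp (-1/t)\<close> of the distances to both faces, scaled by
  \<open>n\<close>. As \<open>n\<close> grows, the scaling makes it converge pointwise, within
  \<open>[0, 1]\<close>, to the indicator function of the open box.
\<close>

definition box_bump :: "nat \<Rightarrow> 'a::euclidean_space \<Rightarrow> 'a \<Rightarrow> 'a \<Rightarrow> real" where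
  "box_bump n a c x = (\<Prod>b\<in>Basis. bump_profile 0 (x \<bullet> (real n *\<^sub>R b) + - (real n * (a \<bullet> b))) *
                       bump_profile 0 (x \<bullet> (- real n *\<^sub>R b) + real n * (c \<bullet> b)))"

lemma box_bump_nonzero: "box_bump n a c x \<noteq> 0 \<longleftrightarrow> n > 0 \<and> x \<in> box a c"
proof -
  have "(box_bump n a c x \<noteq> 0) = (\<forall>b\<in>Basis. real n * (a \<bullet> b) < real n * (x \<bullet> b) \<and> real n * (x \<bullet> b) < real n * (c \<bullet> b))"
    unfolding box_bump_def bump_profile_def prod_zero_iff[OF finite_Basis] 
    by auto
  also have "\<dots> = (n > 0 \<and> x \<in> box a c)"
    by (cases "n = 0") (use nonempty_Basis in \<open>auto simp: box_def\<close>)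
  finally show ?thesis .
qed

lemma box_bump_test_function: "box_bump n a c \<in> test_functions"
proof -
  have "{x. box_bump n a c x \<noteq> 0} \<subseteq> cbox a c"
    using box_subset_cbox by (auto simp: box_bump_nonzero)
  then have "compact (closure {x. box_bump n a c x \<noteq> 0})"
    by (meson bounded_cbox bounded_subset compact_closure)
  moreover have "C_k k (box_bump n a c)" for k
    unfolding box_bump_def by (intro C_k_prod C_k_mult C_k_bump_profile finite_Basis)
  ultimately show ?thesis by (simp add: test_functions_def)
qed

lemma box_bump_bounds: "0 \<le> box_bump n a c x" "box_bump n a c x \<le> 1"
proof -
  have b: "0 \<le> bump_profile 0 t" "bump_profile 0 t \<le> 1" for t
    by (auto simp: bump_profile_def)
  then show "0 \<le> box_bump n a c x" by (simp add: box_bump_def prod_nonneg)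
  show "box_bump n a c x \<le> 1"
    unfolding box_bump_def by (rule prod_le_1) (simp add: b mult_le_one)
qed

lemma box_bump_tendsto: "(\<lambda>n. box_bump n a c x) \<longlonglongrightarrow> indicat_real (box a c) x"
proof (cases "x \<in> box a c")
  case True
  have *: "(\<lambda>n. bump_profile 0 (real n * s)) \<longlonglongrightarrow> 1" if "s > 0" for s
  proof -
    have "(\<lambda>n. exp (- (inverse s * inverse (real n)))) \<longlonglongrightarrow> exp (- (inverse s * 0))"
      by (intro tendsto_intros lim_inverse_n)
    moreover have "\<forall>\<^sub>F n in sequentially. exp (- (inverse s * inverse (real n))) = bump_profile 0 (real n * s)"
      by (rule eventually_mono[OF eventually_gt_at_top[of 0]])
         (use that in \<open>auto simp: bump_profile_def\<close>)
    ultimately have "(\<lambda>n. bump_profile 0 (real n * s)) \<longlonglongrightarrow> exp (- (inverse s * 0))"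
      by (rule Lim_transform_eventually)
    then show ?thesis by simp
  qed
  have "(\<lambda>n. box_bump n a c x) \<longlonglongrightarrow> (\<Prod>b\<in>(Basis::'a set). 1 * 1)"
    unfolding box_bump_def
  proof (intro tendsto_prod tendsto_mult)
    fix b :: 'a assume "b \<in> Basis"
    with True have "x \<bullet> b - a \<bullet> b > 0" "c \<bullet> b - x \<bullet> b > 0" by (auto simp: box_def)
    from this[THEN *]
    show "(\<lambda>n. bump_profile 0 (x \<bullet> real n *\<^sub>R b + - (real n * (a \<bullet> b)))) \<longlonglongrightarrow> 1"
      "(\<lambda>n. bump_profile 0 (x \<bullet> (- real n *\<^sub>R b) + real n * (c \<bullet> b))) \<longlonglongrightarrow> 1"
      by (auto simp: algebra_simps)
  qed
  then show ?thesis using True by simp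
next
  case False
  then have "box_bump n a c x = 0" for n using box_bump_nonzero by blast
  then show ?thesis using False by simp
qed

lemma test_function_has_derivative:
  "\<phi> \<in> test_functions \<Longrightarrow> (\<phi> has_derivative frechet_derivative \<phi> (at x)) (at x)"
  using C_k_SucD[of 0] by (auto simp: test_functions_def simp del: C_k.simps)

lemma test_function_deriv_continuous:
  "\<phi> \<in> test_functions \<Longrightarrow> continuous_on UNIV (\<lambda>x. frechet_derivative \<phi> (at x) v)"
proof -
  assume "\<phi> \<in> test_functions"
  then have "C_k (Suc 0) \<phi>" by (auto simp: test_functions_def simp del: C_k.simps)
  then show ?thesis by simp
qed

lemma test_function_continuous: "\<phi> \<in> test_functions \<Longrightarrow> continuous_on UNIV \<phi>"
  by (auto simp: test_functions_def dest!: spec[of _ 0])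

lemma test_function_deriv_support:
  assumes "\<phi> \<in> test_functions" "x \<notin> closure {x. \<phi> x \<noteq> 0}"
  shows "frechet_derivative \<phi> (at x) v = 0"
proof -
  have zero: "0 = \<phi> y" if "y \<in> - closure {x. \<phi> x \<noteq> 0}" for y
    using that closure_subset[of "{x. \<phi> x \<noteq> 0}"] by auto
  have "(\<phi> has_derivative (\<lambda>_. 0)) (at x)"
    by (rule has_derivative_transform_within_open[OF has_derivative_const _ _ zero,
          where s="- closure {x. \<phi> x \<noteq> 0}"])
       (use assms(2) in auto)
  then have "frechet_derivative \<phi> (at x) = (\<lambda>_. 0)" by (metis frechet_derivative_at)
  then show ?thesis by simp
qed

lemma locally_integrable_measurable:
  assumes "locally_integrable f"
  shows "f \<in> borel_measurable lborel"
proof (rule borel_measurable_LIMSEQ_metric)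
  show "(\<lambda>x. indicat_real (cball 0 (real n)) x *\<^sub>R f x) \<in> borel_measurable lborel" for n
    using assms unfolding locally_integrable_def set_integrable_def by (auto dest: spec[of _ "cball 0 (real n)"])
  show "(\<lambda>n. indicat_real (cball 0 (real n)) x *\<^sub>R f x) \<longlonglongrightarrow> f x" for x
  proof (rule tendsto_eventually)
    obtain m where "norm x \<le> real m" using real_arch_simple by blast
    then show "\<forall>\<^sub>F n in sequentially. indicat_real (cball 0 (real n)) x *\<^sub>R f x = f x"
      by (intro eventually_sequentiallyI[of m]) (auto simp: indicator_def)
  qed
qed

lemma integrable_compact_mult:
  assumes "locally_integrable g" "continuous_on UNIV \<phi>" "compact K" "\<And>x. x \<notin> K \<Longrightarrow> \<phi> x = 0"
  shows "integrable lborel (\<lambda>x. \<phi> x *\<^sub>R g x)"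
proof -
  obtain B where B: "\<And>x. x \<in> K \<Longrightarrow> norm (\<phi> x) \<le> B"
    using compact_continuous_image[OF continuous_on_subset[OF assms(2) subset_UNIV] assms(3), THEN compact_imp_bounded]
    unfolding bounded_iff by blast
  have "integrable lborel (\<lambda>x. indicat_real K x *\<^sub>R g x)"
    using assms by (simp add: locally_integrable_def set_integrable_def)
  then have "integrable lborel (\<lambda>x. B *\<^sub>R (indicat_real K x *\<^sub>R g x))"
    by (rule integrable_scaleR_right)
  then show ?thesis
  proof (rule Bochner_Integration.integrable_bound)
    have [measurable]: "\<phi> \<in> borel_measurable borel" by (rule borel_measurable_continuous_onI[OF assms(2)])
    have [measurable]: "g \<in> borel_measurable borel" using locally_integrable_measurable[OF assms(1)] by simp
    show "(\<lambda>x. \<phi> x *\<^sub>R g x) \<in> borel_measurable lborel" by measurable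
    show "AE x in lborel. norm (\<phi> x *\<^sub>R g x) \<le> norm (B *\<^sub>R indicat_real K x *\<^sub>R g x)"
    proof (intro AE_I2)
      fix x show "norm (\<phi> x *\<^sub>R g x) \<le> norm (B *\<^sub>R indicat_real K x *\<^sub>R g x)"
        using B[of x] assms(4)[of x] by (cases "x \<in> K") (auto intro!: mult_right_mono)
    qed
  qed
qed

lemma test_function_support_compact:
  "\<phi> \<in> test_functions \<Longrightarrow> compact (closure {x. \<phi> x \<noteq> 0})"
  by (simp add: test_functions_def del: C_k.simps)

lemma test_function_mult_integrable:
  assumes \<phi>: "\<phi> \<in> test_functions" and g: "locally_integrable g"
  shows "integrable lborel (\<lambda>x. \<phi> x *\<^sub>R g x)"
proof (rule integrable_compact_mult[OF g test_function_continuous[OF \<phi>] test_function_support_compact[OF \<phi>]])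
  show "\<phi> x = 0" if "x \<notin> closure {x. \<phi> x \<noteq> 0}" for x
    using that closure_subset[of "{x. \<phi> x \<noteq> 0}"] by blast
qed

lemma test_function_deriv_mult_integrable:
  assumes \<phi>: "\<phi> \<in> test_functions" and g: "locally_integrable g"
  shows "integrable lborel (\<lambda>x. frechet_derivative \<phi> (at x) v *\<^sub>R g x)"
  by (rule integrable_compact_mult[OF g test_function_deriv_continuous[OF \<phi>]
        test_function_support_compact[OF \<phi>] test_function_deriv_support[OF \<phi>]])

text \<open>
  Boxes generate the Borel sets and are stable under intersection, so by Dynkin's argument the
  integral vanishes on every Borel set.
\<close>

lemma integral_zero_on_boxes_imp_AE_zero:
  fixes g :: "'a::euclidean_space \<Rightarrow> complex"
  assumes int: "integrable lborel g" and boxes: "\<And>a c. set_lebesgue_integral lborel (box a c) g = 0"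
  shows "AE x in lborel. g x = 0"
proof (rule sigma_finite_measure.density_zero[OF lborel.sigma_finite_measure_axioms int])
  have si: "set_integrable lborel A g" if "A \<in> sets borel" for A
    unfolding set_integrable_def by (rule integrable_mult_indicator[OF _ int]) (simp add: that)
  fix A :: "'a set" assume "A \<in> sets lborel"
  have sb: "sets (borel :: 'a measure) = sigma_sets UNIV (range (\<lambda>(a, b). box a b))"
    by (subst borel_eq_box, rule sets_measure_of) simp
  from \<open>A \<in> sets lborel\<close> have A: "A \<in> sigma_sets UNIV (range (\<lambda>(a, b). box a b))"
    by (simp add: sb[symmetric])
  have UN0: "set_lebesgue_integral lborel UNIV g = 0"
  proof -
    have "(\<lambda>n. set_lebesgue_integral lborel (box (- real n *\<^sub>R One) (real n *\<^sub>R One)) g)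
        \<longlonglongrightarrow> set_lebesgue_integral lborel UNIV g"
      unfolding set_lebesgue_integral_def
    proof (rule integral_dominated_convergence[where w="\<lambda>x. norm (g x)"])
      show "AE x in lborel. (\<lambda>n. indicat_real (box (- real n *\<^sub>R One) (real n *\<^sub>R One)) x *\<^sub>R g x)
           \<longlonglongrightarrow> indicat_real UNIV x *\<^sub>R g x"
      proof (intro AE_I2 tendsto_eventually)
        fix x :: 'a
        obtain m where m: "norm x < real m" using reals_Archimedean2 by blast
        show "\<forall>\<^sub>F n in sequentially. indicat_real (box (- real n *\<^sub>R One) (real n *\<^sub>R One)) x *\<^sub>R g x = indicat_real UNIV x *\<^sub>R g x"
        proof (intro eventually_sequentiallyI[of m])
          fix n assume "m \<le> n"
          then have "x \<in> box (- real n *\<^sub>R One) (real n *\<^sub>R One)"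
            using m by (auto simp: box_def abs_less_iff dest!: Basis_le_norm[of _ x])
          then show "indicat_real (box (- real n *\<^sub>R One) (real n *\<^sub>R One)) x *\<^sub>R g x = indicat_real UNIV x *\<^sub>R g x" by simp
        qed
      qed
    qed (use int in \<open>auto simp: indicator_def\<close>)
    then have "(\<lambda>n::nat. 0) \<longlonglongrightarrow> set_lebesgue_integral lborel UNIV g"
      by (simp only: boxes)
    then show ?thesis by (rule LIMSEQ_unique[OF _ tendsto_const])
  qed
  have "Int_stable (range (\<lambda>(a, b). box a b :: 'a set))"
    by (auto simp: Int_stable_def box_Int_box)
  moreover have "range (\<lambda>(a, b). box a b :: 'a set) \<subseteq> Pow UNIV" by simp
  ultimately show "set_lebesgue_integral lborel A g = 0"
    using A
  proof (induction rule: sigma_sets_induct_disjoint)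
    case (basic A) then show ?case using boxes by auto
  next
    case empty show ?case by (simp add: set_lebesgue_integral_def)
  next
    case (compl A)
    then have "A \<in> sets borel" by (simp add: sb)
    then have "set_lebesgue_integral lborel (A \<union> (UNIV - A)) g = set_lebesgue_integral lborel A g + set_lebesgue_integral lborel (UNIV - A) g"
      by (intro set_integral_Un si) auto
    moreover have "A \<union> (UNIV - A) = UNIV" by auto
    ultimately show ?case using compl UN0 by (simp del: Un_Diff_cancel)
  next
    case (union F)
    then have F: "F i \<in> sets borel" for i by (auto simp: sb)
    have "set_lebesgue_integral lborel (\<Union>i. F i) g = (\<Sum>i. set_lebesgue_integral lborel (F i) g)"
      by (rule lebesgue_integral_countable_add)
         (use F union(1) in \<open>auto simp: disjoint_family_on_def intro!: si\<close>)
    then show ?case using union by simp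
  qed
qed

text \<open>
  The fundamental lemma of the calculus of variations. Dominated convergence along
  \<open>box_bump\<close> gives a zero integral over every box. Since \<open>g\<close> is only
  locally integrable, the box criterion is applied to its truncations to an exhausting sequence
  of boxes.
\<close>

lemma fundamental_lemma:
  fixes g :: "'a::euclidean_space \<Rightarrow> complex"
  assumes g: "locally_integrable g"
    and zero: "\<And>\<phi>. \<phi> \<in> test_functions \<Longrightarrow> (\<integral>x. \<phi> x *\<^sub>R g x \<partial>lborel) = 0"
  shows "AE x in lborel. g x = 0"
proof -
  have [measurable]: "g \<in> borel_measurable borel" using locally_integrable_measurable[OF g] by simp
  have gint: "integrable lborel (\<lambda>x. indicat_real (box a c) x *\<^sub>R g x)" for a c
  proof -
    have "set_integrable lborel (cbox a c) g" using g by (simp add: locally_integrable_def)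
    then have "set_integrable lborel (box a c) g"
      by (rule set_integrable_subset) (auto simp: box_subset_cbox)
    then show ?thesis by (simp add: set_integrable_def)
  qed
  have box0: "(\<integral>x. indicat_real (box a c) x *\<^sub>R g x \<partial>lborel) = 0" for a c
  proof -
    have "(\<lambda>n. \<integral>x. box_bump n a c x *\<^sub>R g x \<partial>lborel) \<longlonglongrightarrow> (\<integral>x. indicat_real (box a c) x *\<^sub>R g x \<partial>lborel)"
    proof (rule integral_dominated_convergence[where w="\<lambda>x. norm (indicat_real (box a c) x *\<^sub>R g x)"])
      have [measurable]: "box_bump n a c \<in> borel_measurable borel" for n
        by (intro borel_measurable_continuous_onI test_function_continuous box_bump_test_function)
      show "(\<lambda>x. box_bump n a c x *\<^sub>R g x) \<in> borel_measurable lborel" for n by measurable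
      show "AE x in lborel. norm (box_bump n a c x *\<^sub>R g x) \<le> norm (indicat_real (box a c) x *\<^sub>R g x)" for n
      proof (intro AE_I2)
        fix x show "norm (box_bump n a c x *\<^sub>R g x) \<le> norm (indicat_real (box a c) x *\<^sub>R g x)"
          using box_bump_bounds[of n a c x] box_bump_nonzero[of n a c x]
          by (cases "x \<in> box a c") (auto simp: mult_left_le_one_le)
      qed
    qed (use gint integrable_norm[OF gint] in \<open>auto intro!: tendsto_intros box_bump_tendsto\<close>)
    then have "(\<lambda>n. 0) \<longlonglongrightarrow> (\<integral>x. indicat_real (box a c) x *\<^sub>R g x \<partial>lborel)"
      by (simp only: zero[OF box_bump_test_function])
    then show ?thesis by (rule LIMSEQ_unique[OF _ tendsto_const])
  qed
  define B where "B = (\<lambda>n. box (- real n *\<^sub>R One) (real n *\<^sub>R (One :: 'a)))"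
  have "AE x in lborel. indicat_real (B n) x *\<^sub>R g x = 0" for n
  proof (rule integral_zero_on_boxes_imp_AE_zero)
    show "integrable lborel (\<lambda>x. indicat_real (B n) x *\<^sub>R g x)"
      unfolding B_def by (rule gint)
    fix a c :: 'a
    obtain a' c' where ac: "box a c \<inter> B n = box a' c'"
      unfolding B_def box_Int_box by blast
    have "indicat_real (box a c) x *\<^sub>R indicat_real (B n) x *\<^sub>R g x
        = indicat_real (box a' c') x *\<^sub>R g x" for x
      unfolding ac[symmetric] indicator_inter_arith scaleR_scaleR ..
    then show "set_lebesgue_integral lborel (box a c) (\<lambda>x. indicat_real (B n) x *\<^sub>R g x) = 0"
      by (simp only: set_lebesgue_integral_def box0)
  qed
  then have "AE x in lborel. \<forall>n. indicat_real (B n) x *\<^sub>R g x = 0"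
    by (subst AE_all_countable) blast
  then show ?thesis
  proof eventually_elim
    case (elim x)
    obtain m where m: "norm x < real m" using reals_Archimedean2 by blast
    then have "x \<in> B m"
      by (auto simp: B_def box_def abs_less_iff dest!: Basis_le_norm[of _ x])
    with elim[rule_format, of m] show ?case by simp
  qed
qed

section \<open>Square integrable functions\<close>

text \<open>
  The real inner product of \<open>L2\<close>, that is, the real part of the Hermitian one. All
  energy identities below only involve this real part, and the phase \<open>cis \<theta>\<close>
  enters through \<open>L2_inner (c h) h = Re c \<parallel>h\<parallel>\<^sup>2\<close>.
\<close>

definition L2_inner :: "('a::euclidean_space \<Rightarrow> complex) \<Rightarrow> ('a \<Rightarrow> complex) \<Rightarrow> real" where
  "L2_inner f g = (\<integral>x. f x \<bullet> g x \<partial>lborel)"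

lemma L2_measurable [measurable_dest]: "f \<in> L2 \<Longrightarrow> f \<in> borel_measurable borel"
  by (simp add: L2_def)

lemma L2_integrable_square: "f \<in> L2 \<Longrightarrow> integrable lborel (\<lambda>x. (norm (f x))\<^sup>2)"
  by (simp add: L2_def)

lemma L2_bound:
  assumes g: "integrable lborel g" and f: "f \<in> borel_measurable borel"
    and le: "\<And>x. (norm (f x))\<^sup>2 \<le> g x"
  shows "f \<in> L2"
proof -
  have "integrable lborel (\<lambda>x. (norm (f x))\<^sup>2)"
    by (rule Bochner_Integration.integrable_bound[OF g])
       (use f le in \<open>auto intro: order_trans[OF le abs_ge_self]\<close>)
  then show ?thesis using f by (simp add: L2_def)
qed

lemma L2_norm_mult_integrable:
  assumes "f \<in> L2" "g \<in> L2"
  shows "integrable lborel (\<lambda>x. norm (f x) * norm (g x))"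
proof (rule Bochner_Integration.integrable_bound)
  show "integrable lborel (\<lambda>x. (norm (f x))\<^sup>2 + (norm (g x))\<^sup>2)"
    using assms by (simp add: L2_integrable_square)
  have "norm (f x) * norm (g x) \<le> (norm (f x))\<^sup>2 + (norm (g x))\<^sup>2" for x
    using sum_squares_bound[of "norm (f x)" "norm (g x)"]
      mult_nonneg_nonneg[OF norm_ge_zero norm_ge_zero, of "f x" "g x"] by linarith
  then show "AE x in lborel. norm (norm (f x) * norm (g x)) \<le> norm ((norm (f x))\<^sup>2 + (norm (g x))\<^sup>2)"
    by (auto simp: abs_mult)
qed (use assms in measurable)

lemma L2_inner_integrable:
  assumes "f \<in> L2" "g \<in> L2"
  shows "integrable lborel (\<lambda>x. f x \<bullet> g x)"
  by (rule Bochner_Integration.integrable_bound[OF L2_norm_mult_integrable[OF assms]])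
     (use assms in \<open>auto simp: abs_mult Cauchy_Schwarz_ineq2\<close>)

lemma L2_scale: "f \<in> L2 \<Longrightarrow> (\<lambda>x. c * f x) \<in> L2"
  by (rule L2_bound[where g="\<lambda>x. (norm c)\<^sup>2 * (norm (f x))\<^sup>2"])
     (auto simp: L2_integrable_square norm_mult power_mult_distrib)

lemma L2_add:
  assumes "f \<in> L2" "g \<in> L2"
  shows "(\<lambda>x. f x + g x) \<in> L2"
proof (rule L2_bound)
  show "integrable lborel (\<lambda>x. 2 * (norm (f x))\<^sup>2 + 2 * (norm (g x))\<^sup>2)"
    using assms by (simp add: L2_integrable_square)
  fix x
  have "(norm (f x + g x))\<^sup>2 \<le> (norm (f x) + norm (g x))\<^sup>2"
    by (rule power_mono[OF norm_triangle_ineq norm_ge_zero])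
  also have "\<dots> \<le> 2 * (norm (f x))\<^sup>2 + 2 * (norm (g x))\<^sup>2"
    using sum_squares_bound[of "norm (f x)" "norm (g x)"] by (simp add: power2_sum)
  finally show "(norm (f x + g x))\<^sup>2 \<le> 2 * (norm (f x))\<^sup>2 + 2 * (norm (g x))\<^sup>2" .
qed (use assms in measurable)

lemma L2_diff: "f \<in> L2 \<Longrightarrow> g \<in> L2 \<Longrightarrow> (\<lambda>x. f x - g x) \<in> L2"
  using L2_add[of f "\<lambda>x. - 1 * g x"] L2_scale[of g "- 1"] by simp

lemma L2_scaleR: "f \<in> L2 \<Longrightarrow> (\<lambda>x. r *\<^sub>R f x) \<in> L2"
  using L2_scale[of f "of_real r"] by (simp add: scaleR_conv_of_real)

lemma L2_zero: "(\<lambda>x. 0) \<in> L2"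
  by (simp add: L2_def)

lemma L2_sum: "(\<And>i. i \<in> A \<Longrightarrow> f i \<in> L2) \<Longrightarrow> (\<lambda>x. \<Sum>i\<in>A. f i x) \<in> L2"
  by (induction A rule: infinite_finite_induct) (auto intro: L2_add L2_zero)

lemma L2_AE_cong:
  assumes "f \<in> L2" "AE x in lborel. f x = g x" "g \<in> borel_measurable borel"
  shows "g \<in> L2"
proof -
  have "integrable lborel (\<lambda>x. (norm (g x))\<^sup>2)"
    by (rule integrable_cong_AE_imp[OF L2_integrable_square[OF assms(1)]])
       (use assms in auto)
  then show ?thesis using assms by (simp add: L2_def)
qed

lemma L2_locally_integrable:
  assumes "f \<in> L2"
  shows "locally_integrable f"
  unfolding locally_integrable_def set_integrable_def
proof (intro allI impI)
  fix K :: "'a set" assume K: "compact K"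
  then have [measurable]: "K \<in> sets borel" by (simp add: borel_compact)
  have [measurable]: "f \<in> borel_measurable borel" using assms by (rule L2_measurable)
  have "integrable lborel (\<lambda>x. indicat_real K x + (norm (f x))\<^sup>2)"
    using K assms by (intro Bochner_Integration.integrable_add L2_integrable_square integrable_real_indicator)
      (use emeasure_compact_finite[OF K] in auto)
  then show "integrable lborel (\<lambda>x. indicat_real K x *\<^sub>R f x)"
  proof (rule Bochner_Integration.integrable_bound)
    have "t \<le> 1 + t\<^sup>2" for t :: real
      using sum_squares_bound[of 1 t] zero_le_power2[of t] unfolding power_one by linarith
    then show "AE x in lborel. norm (indicat_real K x *\<^sub>R f x) \<le> norm (indicat_real K x + (norm (f x))\<^sup>2)"
      by (auto simp: indicator_def)
  qed simp
qed

lemma L2_norm_nonneg [simp]: "0 \<le> L2_norm f"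
  by (simp add: L2_norm_def)

lemma L2_norm_eq_inner: "(L2_norm f)\<^sup>2 = L2_inner f f"
  by (simp add: L2_norm_def L2_inner_def power2_norm_eq_inner)

lemma L2_norm_square: "(L2_norm f)\<^sup>2 = (\<integral>x. (norm (f x))\<^sup>2 \<partial>lborel)"
  by (simp add: L2_norm_def)

lemma L2_norm_zero_AE:
  assumes "f \<in> L2" "L2_norm f = 0"
  shows "AE x in lborel. f x = 0"
proof -
  have "(\<integral>x. (norm (f x))\<^sup>2 \<partial>lborel) = 0" using assms by (simp add: L2_norm_def)
  then have "AE x in lborel. (norm (f x))\<^sup>2 = 0"
    using integral_nonneg_eq_0_iff_AE[OF L2_integrable_square[OF assms(1)]] by simp
  then show ?thesis by simp
qed

text \<open>
  If neither norm vanishes, expand the nonnegative integral of \<open>(c |f| - a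
  |g|)\<^sup>2\<close>, where \<open>a\<close> and \<open>c\<close> are the norms of
  \<open>f\<close> and \<open>g\<close>.
\<close>

lemma L2_Cauchy_Schwarz_norm:
  assumes f: "f \<in> L2" and g: "g \<in> L2"
  shows "(\<integral>x. norm (f x) * norm (g x) \<partial>lborel) \<le> L2_norm f * L2_norm g"
proof (cases "L2_norm f = 0 \<or> L2_norm g = 0")
  case True
  then have "AE x in lborel. norm (f x) * norm (g x) = 0"
    using L2_norm_zero_AE[OF f] L2_norm_zero_AE[OF g] by auto
  then have "(\<integral>x. norm (f x) * norm (g x) \<partial>lborel) = 0" by (rule integral_eq_zero_AE)
  then show ?thesis by simp
next
  case False
  define a c where "a = L2_norm f" and "c = L2_norm g"
  have pos: "a * c > 0" using False by (simp add: a_def c_def less_le)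
  have "0 \<le> (\<integral>x. (c * norm (f x) - a * norm (g x))\<^sup>2 \<partial>lborel)" by simp
  also have "\<dots> = (\<integral>x. c\<^sup>2 * (norm (f x))\<^sup>2 + a\<^sup>2 * (norm (g x))\<^sup>2 - 2 * (a * c) * (norm (f x) * norm (g x)) \<partial>lborel)"
    by (simp add: power2_diff power_mult_distrib algebra_simps)
  also have "\<dots> = c\<^sup>2 * a\<^sup>2 + a\<^sup>2 * c\<^sup>2 - 2 * (a * c) * (\<integral>x. norm (f x) * norm (g x) \<partial>lborel)"
    using L2_integrable_square[OF f] L2_integrable_square[OF g] L2_norm_mult_integrable[OF f g]
    by (simp add: a_def c_def L2_norm_square)
  finally have "2 * (a * c) * (\<integral>x. norm (f x) * norm (g x) \<partial>lborel) \<le> 2 * (a * c) * (a * c)"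
    by (simp add: power2_eq_square algebra_simps)
  then have "(\<integral>x. norm (f x) * norm (g x) \<partial>lborel) \<le> a * c"
    by (rule mult_left_le_imp_le) (use pos in simp)
  then show ?thesis by (simp add: a_def c_def)
qed

lemma L2_Cauchy_Schwarz:
  assumes f: "f \<in> L2" and g: "g \<in> L2"
  shows "\<bar>L2_inner f g\<bar> \<le> L2_norm f * L2_norm g"
proof -
  have "\<bar>L2_inner f g\<bar> \<le> (\<integral>x. norm (f x \<bullet> g x) \<partial>lborel)"
    unfolding L2_inner_def using integral_norm_bound[of lborel "\<lambda>x. f x \<bullet> g x"] by simp
  also have "\<dots> \<le> (\<integral>x. norm (f x) * norm (g x) \<partial>lborel)"
    using assms by (intro integral_mono integrable_norm L2_inner_integrable L2_norm_mult_integrable)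
      (auto simp: Cauchy_Schwarz_ineq2)
  finally show ?thesis using L2_Cauchy_Schwarz_norm[OF assms] by linarith
qed

lemma L2_inner_commute: "L2_inner f g = L2_inner g f"
  by (simp add: L2_inner_def inner_commute)

lemma L2_inner_add_left:
  "f \<in> L2 \<Longrightarrow> g \<in> L2 \<Longrightarrow> h \<in> L2 \<Longrightarrow> L2_inner (\<lambda>x. f x + g x) h = L2_inner f h + L2_inner g h"
  by (simp add: L2_inner_def inner_add_left L2_inner_integrable)

lemma L2_inner_add_right:
  "f \<in> L2 \<Longrightarrow> g \<in> L2 \<Longrightarrow> h \<in> L2 \<Longrightarrow> L2_inner h (\<lambda>x. f x + g x) = L2_inner h f + L2_inner h g"
  by (simp add: L2_inner_def inner_add_right L2_inner_integrable)

lemma L2_inner_diff_left: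
  "f \<in> L2 \<Longrightarrow> g \<in> L2 \<Longrightarrow> h \<in> L2 \<Longrightarrow> L2_inner (\<lambda>x. f x - g x) h = L2_inner f h - L2_inner g h"
  by (simp add: L2_inner_def inner_diff_left L2_inner_integrable)

lemma L2_inner_diff_right:
  "f \<in> L2 \<Longrightarrow> g \<in> L2 \<Longrightarrow> h \<in> L2 \<Longrightarrow> L2_inner h (\<lambda>x. f x - g x) = L2_inner h f - L2_inner h g"
  by (simp add: L2_inner_def inner_diff_right L2_inner_integrable)

lemma L2_inner_scaleR_left: "L2_inner (\<lambda>x. r *\<^sub>R f x) g = r * L2_inner f g"
  by (simp add: L2_inner_def)

lemma L2_inner_scaleR_right: "L2_inner f (\<lambda>x. r *\<^sub>R g x) = r * L2_inner f g"
  by (simp add: L2_inner_def)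

lemma L2_inner_sum_left:
  assumes "finite A" "\<And>i. i \<in> A \<Longrightarrow> f i \<in> L2" "g \<in> L2"
  shows "L2_inner (\<lambda>x. \<Sum>i\<in>A. f i x) g = (\<Sum>i\<in>A. L2_inner (f i) g)"
  using assms by (simp add: L2_inner_def inner_sum_left L2_inner_integrable)

lemma L2_inner_AE_cong:
  assumes "f \<in> L2" "g \<in> L2" "f' \<in> L2" "g' \<in> L2"
    and "AE x in lborel. f x = f' x" "AE x in lborel. g x = g' x"
  shows "L2_inner f g = L2_inner f' g'"
  unfolding L2_inner_def
  by (rule integral_cong_AE) (use assms in \<open>auto simp: L2_def\<close>)

lemma L2_norm_AE_cong:
  assumes "f \<in> L2" "f' \<in> L2" and "AE x in lborel. f x = f' x"
  shows "L2_norm f = L2_norm f'"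
  by (metis L2_inner_AE_cong[OF assms(1,1,2,2,3,3)] L2_norm_eq_inner L2_norm_nonneg power2_eq_imp_eq)

lemma L2_inner_tendsto:
  assumes L2: "\<forall>\<^sub>F s in F. f s \<in> L2" "\<forall>\<^sub>F s in F. g s \<in> L2" "f0 \<in> L2" "g0 \<in> L2"
    and f: "((\<lambda>s. L2_norm (\<lambda>x. f s x - f0 x)) \<longlongrightarrow> 0) F"
    and g: "((\<lambda>s. L2_norm (\<lambda>x. g s x - g0 x)) \<longlongrightarrow> 0) F"
  shows "((\<lambda>s. L2_inner (f s) (g s)) \<longlongrightarrow> L2_inner f0 g0) F"
proof -
  define B where "B s = L2_norm (\<lambda>x. f s x - f0 x) * L2_norm (\<lambda>x. g s x - g0 x)
      + L2_norm f0 * L2_norm (\<lambda>x. g s x - g0 x) + L2_norm (\<lambda>x. f s x - f0 x) * L2_norm g0" for s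
  have "(B \<longlongrightarrow> 0 * 0 + L2_norm f0 * 0 + 0 * L2_norm g0) F"
    unfolding B_def by (intro tendsto_intros f g)
  then have B0: "(B \<longlongrightarrow> 0) F" by simp
  have "\<forall>\<^sub>F s in F. norm (L2_inner (f s) (g s) - L2_inner f0 g0) \<le> B s"
    using L2(1,2)
  proof eventually_elim
    case (elim s)
    define df dg where "df = (\<lambda>x. f s x - f0 x)" and "dg = (\<lambda>x. g s x - g0 x)"
    have [simp]: "df \<in> L2" "dg \<in> L2" using elim L2 by (auto simp: df_def dg_def L2_diff)
    have "L2_inner (f s) (g s) = L2_inner (\<lambda>x. df x + f0 x) (\<lambda>x. dg x + g0 x)"
      by (simp add: df_def dg_def)
    also have "\<dots> = L2_inner df dg + L2_inner f0 dg + L2_inner df g0 + L2_inner f0 g0"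
      using L2 by (simp add: L2_inner_add_left L2_inner_add_right L2_add)
    finally have "L2_inner (f s) (g s) - L2_inner f0 g0 = L2_inner df dg + L2_inner f0 dg + L2_inner df g0"
      by simp
    then show ?case
      using L2_Cauchy_Schwarz[of df dg] L2_Cauchy_Schwarz[of f0 dg] L2_Cauchy_Schwarz[of df g0] L2
      by (simp add: B_def df_def[symmetric] dg_def[symmetric])
  qed
  from Lim_null_comparison[OF this B0] show ?thesis by (simp add: LIM_zero_iff)
qed

lemma L2_norm_add_le:
  assumes f: "f \<in> L2" and g: "g \<in> L2"
  shows "L2_norm (\<lambda>x. f x + g x) \<le> L2_norm f + L2_norm g"
proof (rule power2_le_imp_le)
  have "(L2_norm (\<lambda>x. f x + g x))\<^sup>2 = (L2_norm f)\<^sup>2 + 2 * L2_inner f g + (L2_norm g)\<^sup>2"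
    unfolding L2_norm_eq_inner using f g
    by (simp add: L2_inner_add_left L2_inner_add_right L2_add L2_inner_commute[of g f])
  also have "\<dots> \<le> (L2_norm f + L2_norm g)\<^sup>2"
    using L2_Cauchy_Schwarz[OF f g] by (simp add: power2_sum)
  finally show "(L2_norm (\<lambda>x. f x + g x))\<^sup>2 \<le> (L2_norm f + L2_norm g)\<^sup>2" .
qed simp

lemma L2_norm_sum_le:
  assumes "finite A" "\<And>i. i \<in> A \<Longrightarrow> f i \<in> L2"
  shows "L2_norm (\<lambda>x. \<Sum>i\<in>A. f i x) \<le> (\<Sum>i\<in>A. L2_norm (f i))"
  using assms
proof (induction A)
  case empty
  then show ?case by (simp add: L2_norm_def)
next
  case (insert i A)
  have "L2_norm (\<lambda>x. f i x + (\<Sum>i\<in>A. f i x)) \<le> L2_norm (f i) + L2_norm (\<lambda>x. \<Sum>i\<in>A. f i x)"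
    using insert by (intro L2_norm_add_le L2_sum) auto
  then show ?case using insert by force
qed

lemma L2_inner_rotate: "L2_inner (\<lambda>x. c * h x) h = Re c * (L2_norm h)\<^sup>2"
proof -
  have "(c * z) \<bullet> z = Re c * (z \<bullet> z)" for z :: complex
    by (simp add: inner_complex_def algebra_simps)
  then show ?thesis by (simp add: L2_inner_def L2_norm_eq_inner)
qed

text \<open>
  A chain rule for functionals along a curve that is differentiable in \<open>L2\<close>.
  Instead of differentiability of \<open>\<Phi>\<close> it asks for a linear approximation
  \<open>A h\<close> of the increment that may depend on \<open>h\<close> and converges, and for
  a remainder that is quadratic in the \<open>L2\<close> increment. This form covers the
  Dirichlet integral, whose increment is linear in the \<open>L2\<close> increment of the curve
  only because \<open>A h\<close> contains the Laplacian at both times.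
\<close>

lemma L2_time_chain_rule:
  assumes du: "has_L2_time_deriv u v t"
    and u: "\<forall>\<^sub>F h in at 0. u (t + h) \<in> L2" and ut: "u t \<in> L2"
    and A: "\<forall>\<^sub>F h in at 0. A h \<in> L2" and A0: "A0 \<in> L2"
    and A_lim: "((\<lambda>h. L2_norm (\<lambda>x. A h x - A0 x)) \<longlongrightarrow> 0) (at 0)"
    and rem: "\<forall>\<^sub>F h in at 0. \<bar>\<Phi> (t + h) - \<Phi> t - L2_inner (A h) (\<lambda>x. u (t + h) x - u t x)\<bar>
        \<le> C * (L2_norm (\<lambda>x. u (t + h) x - u t x))\<^sup>2"
  shows "(\<Phi> has_real_derivative L2_inner A0 v) (at t)"
proof -
  define q where "q h = (\<lambda>x. (u (t + h) x - u t x) /\<^sub>R h)" for h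
  have v: "v \<in> L2" and q_lim: "((\<lambda>h. L2_norm (\<lambda>x. q h x - v x)) \<longlongrightarrow> 0) (at 0)"
    using du by (auto simp: has_L2_time_deriv_def q_def)
  have q: "\<forall>\<^sub>F h in at 0. q h \<in> L2"
    using u by eventually_elim (auto simp: q_def intro!: L2_scaleR L2_diff ut)
  have lim1: "((\<lambda>h. L2_inner (A h) (q h)) \<longlongrightarrow> L2_inner A0 v) (at 0)"
    by (rule L2_inner_tendsto[OF A q A0 v A_lim q_lim])
  have "((\<lambda>h. \<bar>C\<bar> * (\<bar>h\<bar> * L2_inner (q h) (q h))) \<longlongrightarrow> \<bar>C\<bar> * (\<bar>0\<bar> * L2_inner v v)) (at 0)"
    by (intro tendsto_intros L2_inner_tendsto[OF q q v v q_lim q_lim])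
  then have lim2: "((\<lambda>h. \<bar>C\<bar> * (\<bar>h\<bar> * L2_inner (q h) (q h))) \<longlongrightarrow> 0) (at 0)" by simp
  have nz: "\<forall>\<^sub>F h in at 0. h \<noteq> (0::real)" by (simp add: eventually_at_filter)
  have "\<forall>\<^sub>F h in at 0. norm ((\<Phi> (t + h) - \<Phi> t) / h - L2_inner (A h) (q h))
      \<le> \<bar>C\<bar> * (\<bar>h\<bar> * L2_inner (q h) (q h))"
    using rem nz
  proof eventually_elim
    case (elim h)
    define \<delta> where "\<delta> = (\<lambda>x. u (t + h) x - u t x)"
    have h: "h \<noteq> 0" using elim by simp
    have \<delta>: "\<delta> = (\<lambda>x. h *\<^sub>R q h x)" using h by (simp add: \<delta>_def q_def fun_eq_iff)
    have n: "(L2_norm \<delta>)\<^sup>2 = h\<^sup>2 * L2_inner (q h) (q h)"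
      unfolding L2_norm_eq_inner \<delta> L2_inner_scaleR_left L2_inner_scaleR_right by (simp add: power2_eq_square)
    have i: "L2_inner (A h) \<delta> = h * L2_inner (A h) (q h)"
      unfolding \<delta> L2_inner_scaleR_right ..
    have "\<bar>\<Phi> (t + h) - \<Phi> t - h * L2_inner (A h) (q h)\<bar> \<le> C * (h\<^sup>2 * L2_inner (q h) (q h))"
      using elim(1) by (simp only: \<delta>_def[symmetric] n i)
    also have "\<dots> \<le> \<bar>C\<bar> * (h\<^sup>2 * L2_inner (q h) (q h))"
      by (intro mult_right_mono) (auto simp: L2_norm_eq_inner[symmetric])
    finally have "\<bar>\<Phi> (t + h) - \<Phi> t - h * L2_inner (A h) (q h)\<bar> / \<bar>h\<bar> \<le> \<bar>C\<bar> * (h\<^sup>2 * L2_inner (q h) (q h)) / \<bar>h\<bar>"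
      by (rule divide_right_mono) simp
    moreover have "\<bar>\<Phi> (t + h) - \<Phi> t - h * L2_inner (A h) (q h)\<bar> / \<bar>h\<bar>
        = norm ((\<Phi> (t + h) - \<Phi> t) / h - L2_inner (A h) (q h))"
      unfolding abs_divide[symmetric] real_norm_def using h by (simp add: field_simps)
    moreover have "\<bar>C\<bar> * (h\<^sup>2 * L2_inner (q h) (q h)) / \<bar>h\<bar> = \<bar>C\<bar> * (\<bar>h\<bar> * L2_inner (q h) (q h))"
      using h by (simp add: field_simps power2_eq_square)
    ultimately show ?case by simp
  qed
  from Lim_null_comparison[OF this lim2]
  have "((\<lambda>h. ((\<Phi> (t + h) - \<Phi> t) / h - L2_inner (A h) (q h)) + L2_inner (A h) (q h)) \<longlongrightarrow> 0 + L2_inner A0 v) (at 0)"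
    by (intro tendsto_add lim1)
  then show ?thesis by (simp add: DERIV_def)
qed

section \<open>Weak derivatives\<close>

lemma has_weak_deriv_unique:
  assumes "has_weak_deriv b f g" "has_weak_deriv b f g'"
  shows "AE x in lborel. g x = g' x"
proof -
  have l: "locally_integrable g" "locally_integrable g'" using assms by (auto simp: has_weak_deriv_def)
  have "AE x in lborel. g x - g' x = 0"
  proof (rule fundamental_lemma)
    show "locally_integrable (\<lambda>x. g x - g' x)"
      using l unfolding locally_integrable_def by (auto intro: set_integral_diff)
    fix \<phi> :: "'a \<Rightarrow> real" assume \<phi>: "\<phi> \<in> test_functions"
    have "(\<integral>x. \<phi> x *\<^sub>R g x \<partial>lborel) = (\<integral>x. \<phi> x *\<^sub>R g' x \<partial>lborel)"
      using assms \<phi> unfolding has_weak_deriv_def by (metis neg_equal_iff_equal)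
    then show "(\<integral>x. \<phi> x *\<^sub>R (g x - g' x) \<partial>lborel) = 0"
      using l \<phi> by (simp add: scaleR_diff_right test_function_mult_integrable)
  qed
  then show ?thesis by simp
qed

lemma has_weak_deriv_diff:
  assumes "has_weak_deriv b f g" "has_weak_deriv b f' g'"
  shows "has_weak_deriv b (\<lambda>x. f x - f' x) (\<lambda>x. g x - g' x)"
  using assms unfolding has_weak_deriv_def
  by (auto simp: scaleR_diff_right test_function_mult_integrable test_function_deriv_mult_integrable)
     (auto simp: locally_integrable_def intro: set_integral_diff)

lemma has_weak_deriv_scale:
  assumes "has_weak_deriv b f g"
  shows "has_weak_deriv b (\<lambda>x. c * f x) (\<lambda>x. c * g x)"
  using assms unfolding has_weak_deriv_def
  by (auto simp: mult_scaleR_right[symmetric] locally_integrable_def simp del: mult_scaleR_right)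

lemma locally_integrable_AE_cong:
  assumes "locally_integrable f" "AE x in lborel. f x = f' x" "f' \<in> borel_measurable borel"
  shows "locally_integrable f'"
  unfolding locally_integrable_def set_integrable_def
proof (intro allI impI)
  fix K :: "'a set" assume K: "compact K"
  then have [measurable]: "K \<in> sets borel" by (simp add: borel_compact)
  have "integrable lborel (\<lambda>x. indicat_real K x *\<^sub>R f x)"
    using K assms by (simp add: locally_integrable_def set_integrable_def)
  then show "integrable lborel (\<lambda>x. indicat_real K x *\<^sub>R f' x)"
    by (rule integrable_cong_AE_imp) (use assms in auto)
qed

text \<open>
  Needed because \<open>weak_deriv\<close> picks an arbitrary representative: second derivatives
  are taken of functions known only up to null sets.
\<close>

lemma has_weak_deriv_AE_cong:
  assumes "has_weak_deriv b f g" "AE x in lborel. f x = f' x" "f' \<in> borel_measurable borel"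
  shows "has_weak_deriv b f' g"
proof -
  have f: "locally_integrable f" using assms by (auto simp: has_weak_deriv_def)
  have f': "locally_integrable f'" using f assms(2,3) by (rule locally_integrable_AE_cong)
  have "(\<integral>x. frechet_derivative \<phi> (at x) b *\<^sub>R f' x \<partial>lborel) = (\<integral>x. frechet_derivative \<phi> (at x) b *\<^sub>R f x \<partial>lborel)"
    if "\<phi> \<in> test_functions" for \<phi>
  proof (rule integral_cong_AE)
    show "(\<lambda>x. frechet_derivative \<phi> (at x) b *\<^sub>R f' x) \<in> borel_measurable lborel"
      "(\<lambda>x. frechet_derivative \<phi> (at x) b *\<^sub>R f x) \<in> borel_measurable lborel"
      using test_function_deriv_mult_integrable[OF that f'] test_function_deriv_mult_integrable[OF that f]
      by (auto dest: borel_measurable_integrable)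
  qed (use assms(2) in auto)
  then show ?thesis using assms f' by (simp add: has_weak_deriv_def)
qed

lemma weak_derivI: "has_weak_deriv b f g \<Longrightarrow> has_weak_deriv b f (weak_deriv b f)"
  unfolding weak_deriv_def by (rule someI[of "has_weak_deriv b f"])

lemma weak_deriv_AE: "has_weak_deriv b f g \<Longrightarrow> AE x in lborel. weak_deriv b f x = g x"
  by (rule has_weak_deriv_unique[OF weak_derivI])

lemma H1_imp_L2: "f \<in> H1 \<Longrightarrow> f \<in> L2"
  by (simp add: H1_def)

lemma H1_has_weak_deriv: "f \<in> H1 \<Longrightarrow> b \<in> Basis \<Longrightarrow> has_weak_deriv b f (weak_deriv b f)"
  by (auto simp: H1_def intro: weak_derivI)

lemma weak_deriv_L2:
  assumes "f \<in> H1" "b \<in> Basis"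
  shows "weak_deriv b f \<in> L2"
proof -
  obtain g where g: "g \<in> L2" "has_weak_deriv b f g" using assms by (auto simp: H1_def)
  have "locally_integrable (weak_deriv b f)"
    using weak_derivI[OF g(2)] by (simp add: has_weak_deriv_def)
  from locally_integrable_measurable[OF this] weak_deriv_AE[OF g(2)] show ?thesis
    by (intro L2_AE_cong[OF g(1)]) auto
qed

lemma H1_diff:
  assumes "f \<in> H1" "g \<in> H1"
  shows "(\<lambda>x. f x - g x) \<in> H1"
  unfolding H1_def
proof (intro CollectI conjI ballI)
  show "(\<lambda>x. f x - g x) \<in> L2" using assms by (intro L2_diff H1_imp_L2)
  fix b :: 'a assume b: "b \<in> Basis"
  have "(\<lambda>x. weak_deriv b f x - weak_deriv b g x) \<in> L2"
    using assms b by (intro L2_diff weak_deriv_L2)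
  moreover have "has_weak_deriv b (\<lambda>x. f x - g x) (\<lambda>x. weak_deriv b f x - weak_deriv b g x)"
    using assms b by (intro has_weak_deriv_diff H1_has_weak_deriv)
  ultimately show "\<exists>k\<in>L2. has_weak_deriv b (\<lambda>x. f x - g x) k" by blast
qed

lemma weak_deriv_diff:
  assumes "f \<in> H1" "g \<in> H1" "b \<in> Basis"
  shows "AE x in lborel. weak_deriv b (\<lambda>x. f x - g x) x = weak_deriv b f x - weak_deriv b g x"
  by (rule weak_deriv_AE) (use assms in \<open>auto intro: has_weak_deriv_diff H1_has_weak_deriv\<close>)

lemma H2_imp_H1: "f \<in> H2 \<Longrightarrow> f \<in> H1"
  by (simp add: H2_def)

lemma H2_weak_deriv_H1: "f \<in> H2 \<Longrightarrow> b \<in> Basis \<Longrightarrow> weak_deriv b f \<in> H1"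
  by (simp add: H2_def)

lemma H1_AE_cong:
  assumes "f \<in> H1" "AE x in lborel. f x = g x" "g \<in> borel_measurable borel"
  shows "g \<in> H1"
  unfolding H1_def
proof (intro CollectI conjI ballI)
  show "g \<in> L2" using assms by (intro L2_AE_cong[OF H1_imp_L2])
  fix b :: 'a assume "b \<in> Basis"
  then have "weak_deriv b f \<in> L2" "has_weak_deriv b g (weak_deriv b f)"
    using assms by (auto intro: weak_deriv_L2 has_weak_deriv_AE_cong[OF H1_has_weak_deriv])
  then show "\<exists>k\<in>L2. has_weak_deriv b g k" by blast
qed

lemma weak_deriv_weak_deriv_diff:
  assumes f: "f \<in> H2" and g: "g \<in> H2" and b: "b \<in> Basis"
  shows "AE x in lborel. weak_deriv b (weak_deriv b (\<lambda>x. f x - g x)) x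
      = weak_deriv b (weak_deriv b f) x - weak_deriv b (weak_deriv b g) x"
proof (rule weak_deriv_AE, rule has_weak_deriv_AE_cong)
  note H = H2_weak_deriv_H1[OF f b] H2_weak_deriv_H1[OF g b]
  show "has_weak_deriv b (\<lambda>x. weak_deriv b f x - weak_deriv b g x)
     (\<lambda>x. weak_deriv b (weak_deriv b f) x - weak_deriv b (weak_deriv b g) x)"
    by (intro has_weak_deriv_diff H1_has_weak_deriv H b)
  show "AE x in lborel. weak_deriv b f x - weak_deriv b g x = weak_deriv b (\<lambda>x. f x - g x) x"
    using weak_deriv_diff[OF H2_imp_H1[OF f] H2_imp_H1[OF g] b] by auto
  show "weak_deriv b (\<lambda>x. f x - g x) \<in> borel_measurable borel"
    by (intro L2_measurable weak_deriv_L2 H1_diff H2_imp_H1 f g b)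
qed

lemma H2_diff:
  assumes f: "f \<in> H2" and g: "g \<in> H2"
  shows "(\<lambda>x. f x - g x) \<in> H2"
  unfolding H2_def
proof (intro CollectI conjI ballI)
  show "(\<lambda>x. f x - g x) \<in> H1" using assms by (auto intro: H1_diff H2_imp_H1)
  fix b :: 'a assume b: "b \<in> Basis"
  show "weak_deriv b (\<lambda>x. f x - g x) \<in> H1"
  proof (rule H1_AE_cong)
    show "(\<lambda>x. weak_deriv b f x - weak_deriv b g x) \<in> H1"
      by (intro H1_diff H2_weak_deriv_H1 f g b)
    show "AE x in lborel. weak_deriv b f x - weak_deriv b g x = weak_deriv b (\<lambda>x. f x - g x) x"
      using weak_deriv_diff[OF H2_imp_H1[OF f] H2_imp_H1[OF g] b] by auto
    show "weak_deriv b (\<lambda>x. f x - g x) \<in> borel_measurable borel"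
      by (intro L2_measurable weak_deriv_L2 H1_diff H2_imp_H1 f g b)
  qed
qed

lemma laplacian_L2: "f \<in> H2 \<Longrightarrow> laplacian f \<in> L2"
  unfolding laplacian_def[abs_def] by (intro L2_sum weak_deriv_L2 H2_weak_deriv_H1)

lemma H1_norm_ge:
  fixes f :: "'a::euclidean_space \<Rightarrow> complex"
  shows
  "L2_norm f \<le> H1_norm f" "b \<in> Basis \<Longrightarrow> L2_norm (weak_deriv b f) \<le> H1_norm f" "0 \<le> H1_norm f"
proof -
  have s: "0 \<le> (\<Sum>b\<in>Basis. (L2_norm (weak_deriv b f))\<^sup>2)" by (intro sum_nonneg) auto
  show "L2_norm f \<le> H1_norm f" unfolding H1_norm_def using s by (intro real_le_rsqrt) auto
  show "0 \<le> H1_norm f" unfolding H1_norm_def using s by simp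
  assume b: "b \<in> Basis"
  have "(L2_norm (weak_deriv b f))\<^sup>2 \<le> (\<Sum>b\<in>Basis. (L2_norm (weak_deriv b f))\<^sup>2)"
    using b by (intro member_le_sum) auto
  also have "\<dots> \<le> (L2_norm f)\<^sup>2 + \<dots>" by simp
  finally show "L2_norm (weak_deriv b f) \<le> H1_norm f" unfolding H1_norm_def by (intro real_le_rsqrt)
qed

lemma H2_norm_ge: "b \<in> Basis \<Longrightarrow> H1_norm (weak_deriv b f) \<le> H2_norm f"
proof -
  assume b: "b \<in> Basis"
  have "(H1_norm (weak_deriv b f))\<^sup>2 \<le> (\<Sum>b\<in>Basis. (H1_norm (weak_deriv b f))\<^sup>2)"
    using b by (intro member_le_sum) auto
  also have "\<dots> \<le> (L2_norm f)\<^sup>2 + \<dots>" by simp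
  finally show ?thesis unfolding H2_norm_def by (intro real_le_rsqrt)
qed

lemma laplacian_diff_L2_norm_le:
  fixes f g :: "'a::euclidean_space \<Rightarrow> complex"
  assumes f: "f \<in> H2" and g: "g \<in> H2"
  shows "L2_norm (\<lambda>x. laplacian f x - laplacian g x) \<le> real DIM('a) * H2_norm (\<lambda>x. f x - g x)"
proof -
  let ?d = "\<lambda>x. f x - g x"
  note d = H2_diff[OF f g]
  have "AE x in lborel. \<forall>b\<in>Basis. weak_deriv b (weak_deriv b ?d) x
      = weak_deriv b (weak_deriv b f) x - weak_deriv b (weak_deriv b g) x"
    by (rule AE_finite_allI[OF finite_Basis]) (rule weak_deriv_weak_deriv_diff[OF f g])
  then have "AE x in lborel. laplacian f x - laplacian g x = laplacian ?d x"
    by eventually_elim (simp add: laplacian_def sum_subtractf[symmetric])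
  then have "L2_norm (\<lambda>x. laplacian f x - laplacian g x) = L2_norm (laplacian ?d)"
    using f g d by (intro L2_norm_AE_cong L2_diff laplacian_L2)
  also have "\<dots> \<le> (\<Sum>b\<in>Basis. L2_norm (weak_deriv b (weak_deriv b ?d)))"
    unfolding laplacian_def[abs_def] using d by (intro L2_norm_sum_le weak_deriv_L2 H2_weak_deriv_H1) auto
  also have "\<dots> \<le> (\<Sum>b\<in>(Basis::'a set). H2_norm ?d)"
    by (intro sum_mono order_trans[OF H1_norm_ge(2) H2_norm_ge])
  finally show ?thesis by simp
qed

section \<open>Translations and integration by parts\<close>

lemma lborel_integral_translate:
  fixes f :: "'a::euclidean_space \<Rightarrow> 'b::{banach, second_countable_topology}"
  assumes "f \<in> borel_measurable borel"
  shows "(\<integral>x. f (x + c) \<partial>lborel) = (\<integral>x. f x \<partial>lborel)"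
proof -
  have "(\<integral>x. f x \<partial>lborel) = (\<integral>x. f x \<partial>distr lborel borel ((+) c))"
    by (simp add: lborel_distr_plus)
  also have "\<dots> = (\<integral>x. f (c + x) \<partial>lborel)"
    using assms by (subst integral_distr) auto
  finally show ?thesis by (simp add: add.commute)
qed

lemma lborel_integrable_translate:
  fixes f :: "'a::euclidean_space \<Rightarrow> 'b::{banach, second_countable_topology}"
  assumes "integrable lborel f"
  shows "integrable lborel (\<lambda>x. f (x + c))"
proof -
  have "integrable (distr lborel borel ((+) c)) f"
    using assms by (simp add: lborel_distr_plus)
  then have "integrable lborel (\<lambda>x. f (c + x))"
    using assms by (subst (asm) integrable_distr_eq) auto
  then show ?thesis by (simp add: add.commute)
qed

lemma L2_translate: "f \<in> L2 \<Longrightarrow> (\<lambda>x. f (x + c)) \<in> L2"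
  using lborel_integrable_translate[of "\<lambda>x. (norm (f x))\<^sup>2" c]
    measurable_compose[of "\<lambda>x. x + c" borel borel f borel] by (simp add: L2_def)

lemma L2_cnj: "f \<in> L2 \<Longrightarrow> (\<lambda>x. cnj (f x)) \<in> L2"
  using measurable_compose[OF _ borel_measurable_continuous_onI[OF continuous_on_cnj[OF continuous_on_id]],
      of f borel] by (simp add: L2_def)

lemma L2_norm_translate:
  assumes "f \<in> L2"
  shows "L2_norm (\<lambda>x. f (x + c)) = L2_norm f"
  unfolding L2_norm_def
  using lborel_integral_translate[of "\<lambda>x. (norm (f x))\<^sup>2" c] L2_measurable[OF assms] by simp

lemma L2_mult_integrable:
  assumes "p \<in> L2" "q \<in> L2"
  shows "integrable lborel (\<lambda>x. p x * q x)"
  by (rule Bochner_Integration.integrable_bound[OF L2_norm_mult_integrable[OF assms]])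
     (use L2_measurable[OF assms(1)] L2_measurable[OF assms(2)] in \<open>auto simp: norm_mult\<close>)

lemma L2_norm_integral_mult_le:
  assumes "p \<in> L2" "q \<in> L2"
  shows "norm (\<integral>x. p x * q x \<partial>lborel) \<le> L2_norm p * L2_norm q"
proof -
  have "norm (\<integral>x. p x * q x \<partial>lborel) \<le> (\<integral>x. norm (p x) * norm (q x) \<partial>lborel)"
    using integral_norm_bound[of lborel "\<lambda>x. p x * q x"] by (simp add: norm_mult)
  also have "\<dots> \<le> L2_norm p * L2_norm q" by (rule L2_Cauchy_Schwarz_norm[OF assms])
  finally show ?thesis .
qed

lemma integrable_indicator_Icc: "integrable lborel (indicat_real {a..b::real})"
  using emeasure_compact_finite[OF compact_Icc, of a b] by (intro integrable_real_indicator) auto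

text \<open>
  By Cauchy-Schwarz and translation invariance the inner integral is bounded uniformly in
  \<open>s\<close>. This justifies every exchange of integrals below.
\<close>

lemma L2_product_translates_integrable:
  fixes p q :: "'a::euclidean_space \<Rightarrow> complex"
  assumes p: "p \<in> L2" and q: "q \<in> L2"
  shows "integrable (lborel \<Otimes>\<^sub>M lborel) (\<lambda>(s, x). indicat_real {0..h} s *\<^sub>R (p x * q (x + s *\<^sub>R v)))"
proof -
  have [measurable]: "p \<in> borel_measurable borel" "q \<in> borel_measurable borel"
    using p q by (auto intro: L2_measurable)
  show ?thesis
  proof (rule lborel_pair.Fubini_integrable)
    have le: "(\<integral>x. norm (p x) * norm (q (x + s *\<^sub>R v)) \<partial>lborel) \<le> L2_norm p * L2_norm q" for s
      using L2_Cauchy_Schwarz_norm[OF p L2_translate[OF q, of "s *\<^sub>R v"]] L2_norm_translate[OF q] by simp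
    show "integrable lborel (\<lambda>s. \<integral>x. norm (case (s, x) of (s, x) \<Rightarrow>
        indicat_real {0..h} s *\<^sub>R (p x * q (x + s *\<^sub>R v))) \<partial>lborel)"
    proof (rule Bochner_Integration.integrable_bound)
      show "integrable lborel (\<lambda>s. indicat_real {0..h} s * (L2_norm p * L2_norm q))"
        by (intro integrable_mult_left integrable_indicator_Icc)
      show "AE s in lborel. norm (\<integral>x. norm (case (s, x) of (s, x) \<Rightarrow>
          indicat_real {0..h} s *\<^sub>R (p x * q (x + s *\<^sub>R v))) \<partial>lborel)
          \<le> norm (indicat_real {0..h} s * (L2_norm p * L2_norm q))"
        using le by (auto simp: norm_mult indicator_def)
    qed measurable
    show "AE s in lborel. integrable lborel (\<lambda>x. case (s, x) of (s, x) \<Rightarrow>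
        indicat_real {0..h} s *\<^sub>R (p x * q (x + s *\<^sub>R v)))"
      using L2_mult_integrable[OF p L2_translate[OF q]] by simp
  qed measurable
qed

definition line_integral :: "real \<Rightarrow> 'a::euclidean_space \<Rightarrow> ('a \<Rightarrow> complex) \<Rightarrow> 'a \<Rightarrow> complex" where
  "line_integral h v g x = (\<integral>s. indicat_real {0..h} s *\<^sub>R g (x + s *\<^sub>R v) \<partial>lborel)"

lemma line_integral_mult_integrable:
  fixes p g :: "'a::euclidean_space \<Rightarrow> complex"
  assumes p: "p \<in> L2" and g: "g \<in> L2"
  shows "integrable lborel (\<lambda>x. p x * line_integral h v g x)" (is ?int)
    and "(\<integral>x. p x * line_integral h v g x \<partial>lborel)
      = (\<integral>s. indicat_real {0..h} s *\<^sub>R (\<integral>x. p x * g (x + s *\<^sub>R v) \<partial>lborel) \<partial>lborel)" (is ?eq)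
    and "integrable lborel (\<lambda>s. indicat_real {0..h} s *\<^sub>R (\<integral>x. p x * g (x + s *\<^sub>R v) \<partial>lborel))" (is ?int2)
proof -
  note I = L2_product_translates_integrable[OF p g, of h v]
  have eq: "(\<integral>s. indicat_real {0..h} s *\<^sub>R (p x * g (x + s *\<^sub>R v)) \<partial>lborel) = p x * line_integral h v g x" for x
    unfolding line_integral_def mult_scaleR_right[symmetric] by (rule integral_mult_right_zero)
  show ?int using lborel_pair.integrable_snd[OF I] by (simp add: eq)
  show ?eq using lborel_pair.Fubini_integral[OF I] by (simp add: eq)
  show ?int2 using lborel_pair.integrable_fst[OF I] by simp
qed

lemma indicator_compact_L2:
  assumes "compact K"
  shows "(\<lambda>x::'a::euclidean_space. complex_of_real (indicat_real K x)) \<in> L2"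
proof -
  have [measurable]: "K \<in> sets borel" using assms by (simp add: borel_compact)
  have "integrable lborel (indicat_real K)"
    using emeasure_compact_finite[OF assms] by (intro integrable_real_indicator) auto
  then show ?thesis
    by (intro L2_bound[where g="indicat_real K"]) (auto simp: indicator_def)
qed

lemma line_integral_locally_integrable:
  assumes g: "g \<in> L2"
  shows "locally_integrable (line_integral h v g)"
  unfolding locally_integrable_def set_integrable_def
  using line_integral_mult_integrable(1)[OF indicator_compact_L2 g]
  by (simp add: scaleR_conv_of_real)

lemma C_k_translate: "C_k k \<phi> \<Longrightarrow> C_k k (\<lambda>x. \<phi> (x + c))"
proof (induction k arbitrary: \<phi>)
  case 0
  then show ?case by (auto intro!: continuous_on_compose2[of UNIV \<phi>] continuous_intros)
next
  case (Suc k)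
  show ?case
  proof (rule C_k_SucI)
    show "((\<lambda>x. \<phi> (x + c)) has_derivative frechet_derivative \<phi> (at (x + c))) (at x)" for x
      by (rule has_derivative_compose[of "\<lambda>x. x + c" "\<lambda>v. v" x UNIV \<phi>, OF _ C_k_SucD[OF Suc.prems]])
         (auto intro!: derivative_eq_intros)
    show "C_k k (\<lambda>x. frechet_derivative \<phi> (at (x + c)) v)" for v
      using Suc.IH[of "\<lambda>x. frechet_derivative \<phi> (at x) v"] Suc.prems by simp
  qed
qed

lemma test_function_deriv_translate:
  assumes "\<phi> \<in> test_functions"
  shows "frechet_derivative (\<lambda>x. \<phi> (x + c)) (at x) = frechet_derivative \<phi> (at (x + c))"
proof -
  have "((\<lambda>x. \<phi> (x + c)) has_derivative frechet_derivative \<phi> (at (x + c))) (at x)"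
    by (rule has_derivative_compose[of "\<lambda>x. x + c" "\<lambda>v. v" x UNIV \<phi>, OF _ test_function_has_derivative[OF assms]])
       (auto intro!: derivative_eq_intros)
  then show ?thesis by (metis frechet_derivative_at)
qed

lemma test_function_translate:
  assumes "\<phi> \<in> test_functions"
  shows "(\<lambda>x. \<phi> (x + c)) \<in> test_functions"
proof -
  define K where "K = closure {x. \<phi> x \<noteq> 0}"
  have "compact K" unfolding K_def using assms by (rule test_function_support_compact)
  then have "compact ((\<lambda>x. x - c) ` K)" by (intro compact_continuous_image continuous_intros)
  moreover have "{x. \<phi> (x + c) \<noteq> 0} \<subseteq> (\<lambda>x. x - c) ` K"
  proof
    fix x assume "x \<in> {x. \<phi> (x + c) \<noteq> 0}"
    then have "x + c \<in> K" using closure_subset[of "{x. \<phi> x \<noteq> 0}"] by (auto simp: K_def)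
    then show "x \<in> (\<lambda>x. x - c) ` K" by (rule rev_image_eqI) simp
  qed
  ultimately have "compact (closure {x. \<phi> (x + c) \<noteq> 0})"
    by (meson bounded_subset compact_closure compact_imp_bounded)
  then show ?thesis using assms C_k_translate by (auto simp: test_functions_def simp del: C_k.simps)
qed

lemma continuous_compact_support_L2:
  assumes c: "continuous_on UNIV \<phi>" and K: "compact K" and z: "\<And>x. x \<notin> K \<Longrightarrow> \<phi> x = 0"
  shows "(\<lambda>x. complex_of_real (\<phi> x)) \<in> L2"
proof -
  obtain B where B: "\<And>x. x \<in> K \<Longrightarrow> norm (\<phi> x) \<le> B"
    using compact_continuous_image[OF continuous_on_subset[OF c subset_UNIV] K, THEN compact_imp_bounded]
    unfolding bounded_iff by blast
  have [measurable]: "K \<in> sets borel" using K by (simp add: borel_compact)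
  have [measurable]: "\<phi> \<in> borel_measurable borel" by (rule borel_measurable_continuous_onI[OF c])
  show ?thesis
  proof (rule L2_bound)
    show "integrable lborel (\<lambda>x. indicat_real K x * B\<^sup>2)"
      using emeasure_compact_finite[OF K] by (intro integrable_mult_left integrable_real_indicator) auto
    fix x
    show "(norm (complex_of_real (\<phi> x)))\<^sup>2 \<le> indicat_real K x * B\<^sup>2"
    proof (cases "x \<in> K")
      case True
      then have "\<bar>\<phi> x\<bar>\<^sup>2 \<le> B\<^sup>2" using B[of x] by (intro power_mono) auto
      then show ?thesis using True by simp
    qed (use z in simp)
  qed measurable
qed

lemma test_function_L2: "\<phi> \<in> test_functions \<Longrightarrow> (\<lambda>x. complex_of_real (\<phi> x)) \<in> L2"
  using closure_subset[of "{x. \<phi> x \<noteq> 0}"]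
  by (intro continuous_compact_support_L2[OF test_function_continuous test_function_support_compact]) auto

lemma test_function_deriv_L2:
  "\<phi> \<in> test_functions \<Longrightarrow> (\<lambda>x. complex_of_real (frechet_derivative \<phi> (at x) v)) \<in> L2"
  by (rule continuous_compact_support_L2[OF test_function_deriv_continuous
        test_function_support_compact test_function_deriv_support])

text \<open>
  The fundamental theorem of calculus along the direction \<open>- v\<close>.
\<close>

lemma test_function_increment:
  assumes \<phi>: "\<phi> \<in> test_functions" and h: "0 \<le> h"
  shows "complex_of_real (\<phi> (x + h *\<^sub>R - v)) - complex_of_real (\<phi> x)
    = - line_integral h (- v) (\<lambda>y. complex_of_real (frechet_derivative \<phi> (at y) v)) x"
proof -
  let ?D = "\<lambda>s. - complex_of_real (frechet_derivative \<phi> (at (x + s *\<^sub>R - v)) v)"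
  have "(\<integral>s. indicat_real {0..h} s *\<^sub>R ?D s \<partial>lborel)
      = complex_of_real (\<phi> (x + h *\<^sub>R - v)) - complex_of_real (\<phi> (x + 0 *\<^sub>R - v))"
  proof (rule integral_FTC_atLeastAtMost[OF h])
    fix s :: real
    have lin: "frechet_derivative \<phi> (at y) (r *\<^sub>R w) = r * frechet_derivative \<phi> (at y) w" for y r w
      using has_derivative_bounded_linear[OF test_function_has_derivative[OF \<phi>, of y]]
      by (simp add: linear_simps)
    have "((\<lambda>s. \<phi> (x + s *\<^sub>R - v)) has_derivative (\<lambda>r. frechet_derivative \<phi> (at (x + s *\<^sub>R - v)) (r *\<^sub>R - v)))
        (at s within {0..h})"
      by (rule has_derivative_compose[OF _ test_function_has_derivative[OF \<phi>], of "\<lambda>s. x + s *\<^sub>R - v"])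
         (auto intro!: derivative_eq_intros)
    then have "((\<lambda>s. \<phi> (x + s *\<^sub>R - v)) has_derivative (\<lambda>r. r * - frechet_derivative \<phi> (at (x + s *\<^sub>R - v)) v))
        (at s within {0..h})"
      using lin[of _ "- _" v] by (simp add: scaleR_minus_left[symmetric] del: scaleR_minus_left)
    then have "((\<lambda>s. \<phi> (x + s *\<^sub>R - v)) has_vector_derivative - frechet_derivative \<phi> (at (x + s *\<^sub>R - v)) v)
        (at s within {0..h})"
      by (simp add: has_vector_derivative_def)
    from bounded_linear.has_vector_derivative[OF bounded_linear_of_real this]
    show "((\<lambda>s. complex_of_real (\<phi> (x + s *\<^sub>R - v))) has_vector_derivative ?D s) (at s within {0..h})"
      by simp
  next
    show "continuous_on {0..h} ?D"
      by (intro continuous_intros continuous_on_compose2[OF test_function_deriv_continuous[OF \<phi>, of v]]) auto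
  qed
  then show ?thesis by (simp add: line_integral_def)
qed

text \<open>
  The fundamental theorem of calculus for weak derivatives. Tested against
  \<open>\<phi>\<close>, the increment of \<open>f\<close> is moved onto \<open>\<phi>\<close>
  by translation, where the classical theorem applies. Under the integral over \<open>s\<close>
  the translates of \<open>\<phi>\<close> are again test functions, so the definition of the
  weak derivative turns \<open>f\<close> into \<open>g\<close>. The fundamental lemma removes
  \<open>\<phi>\<close>.
\<close>

lemma weak_deriv_increment:
  assumes w: "has_weak_deriv v f g" and f: "f \<in> L2" and g: "g \<in> L2" and h: "0 \<le> h"
  shows "AE x in lborel. f (x + h *\<^sub>R v) - f x = line_integral h v g x"
proof -
  note [measurable] = L2_measurable[OF f] L2_measurable[OF g]
  have loc: "locally_integrable (\<lambda>x. f (x + h *\<^sub>R v) - f x)"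
    by (intro L2_locally_integrable L2_diff L2_translate f)
  have locG: "locally_integrable (line_integral h v g)"
    by (rule line_integral_locally_integrable[OF g])
  have "AE x in lborel. (f (x + h *\<^sub>R v) - f x) - line_integral h v g x = 0"
  proof (rule fundamental_lemma)
    show "locally_integrable (\<lambda>x. (f (x + h *\<^sub>R v) - f x) - line_integral h v g x)"
      using loc locG unfolding locally_integrable_def by (auto intro: set_integral_diff)
    fix \<phi> :: "'a \<Rightarrow> real" assume \<phi>: "\<phi> \<in> test_functions"
    let ?\<phi> = "\<lambda>x. complex_of_real (\<phi> x)"
    let ?d = "\<lambda>x. complex_of_real (frechet_derivative \<phi> (at x) v)"
    note P = test_function_L2[OF \<phi>] and D = test_function_deriv_L2[OF \<phi>, of v]
    note [measurable] = L2_measurable[OF P]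
    have "(\<integral>x. \<phi> x *\<^sub>R (f (x + h *\<^sub>R v) - f x) \<partial>lborel)
        = (\<integral>x. ?\<phi> x * f (x + h *\<^sub>R v) \<partial>lborel) - (\<integral>x. ?\<phi> x * f x \<partial>lborel)"
      using L2_mult_integrable[OF P L2_translate[OF f]] L2_mult_integrable[OF P f]
      by (simp add: scaleR_conv_of_real right_diff_distrib)
    also have "(\<integral>x. ?\<phi> x * f (x + h *\<^sub>R v) \<partial>lborel) = (\<integral>x. ?\<phi> (x + h *\<^sub>R - v) * f x \<partial>lborel)"
      using lborel_integral_translate[of "\<lambda>x. ?\<phi> (x + h *\<^sub>R - v) * f x" "h *\<^sub>R v"] by simp
    also have "\<dots> - (\<integral>x. ?\<phi> x * f x \<partial>lborel) = (\<integral>x. f x * (?\<phi> (x + h *\<^sub>R - v) - ?\<phi> x) \<partial>lborel)"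
      using L2_mult_integrable[OF L2_translate[OF P] f, of "h *\<^sub>R - v"] L2_mult_integrable[OF P f]
      by (simp add: left_diff_distrib mult.commute[of "f _"])
    also have "\<dots> = - (\<integral>x. f x * line_integral h (- v) ?d x \<partial>lborel)"
      by (simp only: test_function_increment[OF \<phi> h] mult_minus_right integral_minus)
    also have "\<dots> = - (\<integral>s. indicat_real {0..h} s *\<^sub>R (\<integral>x. f x * ?d (x + s *\<^sub>R - v) \<partial>lborel) \<partial>lborel)"
      by (simp only: line_integral_mult_integrable(2)[OF f D])
    also have "\<dots> = - (\<integral>s. indicat_real {0..h} s *\<^sub>R (- (\<integral>x. ?\<phi> x * g (x + s *\<^sub>R v) \<partial>lborel)) \<partial>lborel)"
    proof -
      have "(\<integral>x. f x * ?d (x + s *\<^sub>R - v) \<partial>lborel) = - (\<integral>x. ?\<phi> x * g (x + s *\<^sub>R v) \<partial>lborel)" for s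
      proof -
        have "(\<integral>x. f x * ?d (x + s *\<^sub>R - v) \<partial>lborel)
            = (\<integral>x. frechet_derivative (\<lambda>x. \<phi> (x + s *\<^sub>R - v)) (at x) v *\<^sub>R f x \<partial>lborel)"
          by (simp only: test_function_deriv_translate[OF \<phi>] scaleR_conv_of_real mult.commute)
        also have "\<dots> = - (\<integral>x. \<phi> (x + s *\<^sub>R - v) *\<^sub>R g x \<partial>lborel)"
          using w test_function_translate[OF \<phi>] unfolding has_weak_deriv_def by blast
        also have "(\<integral>x. \<phi> (x + s *\<^sub>R - v) *\<^sub>R g x \<partial>lborel) = (\<integral>x. ?\<phi> x * g (x + s *\<^sub>R v) \<partial>lborel)"
          using lborel_integral_translate[of "\<lambda>x. ?\<phi> (x + s *\<^sub>R - v) * g x" "s *\<^sub>R v"]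
          by (simp add: scaleR_conv_of_real)
        finally show ?thesis .
      qed
      then show ?thesis by (simp only:)
    qed
    also have "\<dots> = (\<integral>s. indicat_real {0..h} s *\<^sub>R (\<integral>x. ?\<phi> x * g (x + s *\<^sub>R v) \<partial>lborel) \<partial>lborel)"
      by simp
    also have "\<dots> = (\<integral>x. ?\<phi> x * line_integral h v g x \<partial>lborel)"
      by (rule line_integral_mult_integrable(2)[OF P g, symmetric])
    finally have "(\<integral>x. \<phi> x *\<^sub>R (f (x + h *\<^sub>R v) - f x) \<partial>lborel) = (\<integral>x. \<phi> x *\<^sub>R line_integral h v g x \<partial>lborel)"
      by (simp add: scaleR_conv_of_real)
    then show "(\<integral>x. \<phi> x *\<^sub>R (f (x + h *\<^sub>R v) - f x - line_integral h v g x) \<partial>lborel) = 0"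
      unfolding scaleR_diff_right[of _ "_ - _"]
      using test_function_mult_integrable[OF \<phi> loc] test_function_mult_integrable[OF \<phi> locG] by simp
  qed
  then show ?thesis by simp
qed

lemma integral_mult_increment:
  assumes w: "has_weak_deriv v f g" and f: "f \<in> L2" and g: "g \<in> L2" and h: "0 \<le> h" and r: "r \<in> L2"
  shows "(\<integral>x. r x * (f (x + h *\<^sub>R v) - f x) \<partial>lborel)
      = (\<integral>s. indicat_real {0..h} s *\<^sub>R (\<integral>x. r x * g (x + s *\<^sub>R v) \<partial>lborel) \<partial>lborel)"
proof -
  have "(\<integral>x. r x * (f (x + h *\<^sub>R v) - f x) \<partial>lborel) = (\<integral>x. r x * line_integral h v g x \<partial>lborel)"
  proof (rule integral_cong_AE)
    show "(\<lambda>x. r x * (f (x + h *\<^sub>R v) - f x)) \<in> borel_measurable lborel"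
      using L2_mult_integrable[OF r L2_diff[OF L2_translate[OF f] f]] by (rule borel_measurable_integrable)
    show "(\<lambda>x. r x * line_integral h v g x) \<in> borel_measurable lborel"
      using line_integral_mult_integrable(1)[OF r g] by (rule borel_measurable_integrable)
  qed (use weak_deriv_increment[OF w f g h] in auto)
  then show ?thesis by (simp only: line_integral_mult_integrable(2)[OF r g])
qed

lemma integral_indicator_scaleR_bound:
  fixes F :: "real \<Rightarrow> complex"
  assumes h: "0 \<le> h" and B: "\<And>s. s \<in> {0..h} \<Longrightarrow> norm (F s) \<le> B"
    and int: "integrable lborel (\<lambda>s. indicat_real {0..h} s *\<^sub>R F s)"
  shows "norm (\<integral>s. indicat_real {0..h} s *\<^sub>R F s \<partial>lborel) \<le> h * B"
proof -
  have "norm (\<integral>s. indicat_real {0..h} s *\<^sub>R F s \<partial>lborel) \<le> (\<integral>s. indicat_real {0..h} s * B \<partial>lborel)"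
  proof (rule Bochner_Integration.integral_norm_bound_integral[OF int])
    show "integrable lborel (\<lambda>s. indicat_real {0..h} s * B)"
      by (intro integrable_mult_left integrable_indicator_Icc)
  qed (use B in \<open>auto simp: indicator_def\<close>)
  also have "\<dots> = h * B" using h by simp
  finally show ?thesis .
qed

text \<open>
  Duality: pair the increment with its own conjugate and estimate the resulting integral over
  \<open>s\<close> by Cauchy-Schwarz.
\<close>

lemma L2_norm_increment_le:
  assumes w: "has_weak_deriv v f g" and f: "f \<in> L2" and g: "g \<in> L2" and h: "0 \<le> h"
  shows "L2_norm (\<lambda>x. f (x + h *\<^sub>R v) - f x) \<le> h * L2_norm g"
proof -
  define d where "d = (\<lambda>x. f (x + h *\<^sub>R v) - f x)"
  have d: "d \<in> L2" unfolding d_def by (intro L2_diff L2_translate f)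
  have cd: "(\<lambda>x. cnj (d x)) \<in> L2" "L2_norm (\<lambda>x. cnj (d x)) = L2_norm d"
    using d by (auto intro: L2_cnj simp: L2_norm_def)
  have "(\<integral>x. cnj (d x) * d x \<partial>lborel) = complex_of_real ((L2_norm d)\<^sup>2)"
    by (simp add: L2_norm_square complex_norm_square[symmetric] mult.commute[of "cnj _"] del: of_real_power)
  then have "(L2_norm d)\<^sup>2 = norm (\<integral>x. cnj (d x) * d x \<partial>lborel)"
    by (simp add: norm_power)
  also have "\<dots> = norm (\<integral>s. indicat_real {0..h} s *\<^sub>R (\<integral>x. cnj (d x) * g (x + s *\<^sub>R v) \<partial>lborel) \<partial>lborel)"
    using integral_mult_increment[OF w f g h cd(1)] by (simp add: d_def)
  also have "\<dots> \<le> h * (L2_norm d * L2_norm g)"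
    using L2_norm_integral_mult_le[OF cd(1) L2_translate[OF g]] line_integral_mult_integrable(3)[OF cd(1) g]
    by (intro integral_indicator_scaleR_bound h) (auto simp: cd(2) L2_norm_translate[OF g])
  finally have "L2_norm d * L2_norm d \<le> L2_norm d * (h * L2_norm g)"
    by (simp add: power2_eq_square algebra_simps)
  then show ?thesis
    using h by (cases "L2_norm d = 0") (auto simp: d_def[symmetric] less_le mult_le_cancel_left)
qed

text \<open>
  Integration by parts for two functions with square integrable weak derivatives, without
  approximation by test functions. The integral of \<open>p q\<close> is invariant under
  translation by \<open>h v\<close>. The discrete product rule writes the vanishing difference
  as an integral over \<open>s \<in> {0..h}\<close> of a quantity \<open>F s\<close>. By
  \<open>L2_norm_increment_le\<close>, \<open>F s\<close> differs by \<open>O(h)\<close> from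
  \<open>I\<close>, the integral of \<open>q g + p k\<close>. Hence \<open>h \<bar>I\<bar> =
  O(h\<^sup>2)\<close> for all \<open>h > 0\<close>, and \<open>I = 0\<close>.
\<close>

lemma integration_by_parts:
  assumes wp: "has_weak_deriv v p g" and p: "p \<in> L2" and g: "g \<in> L2"
    and wq: "has_weak_deriv v q k" and q: "q \<in> L2" and k: "k \<in> L2"
  shows "(\<integral>x. g x * q x \<partial>lborel) = - (\<integral>x. p x * k x \<partial>lborel)"
proof -
  note [measurable] = L2_measurable[OF p] L2_measurable[OF q] L2_measurable[OF g] L2_measurable[OF k]
  define I where "I = (\<integral>x. q x * g x \<partial>lborel) + (\<integral>x. p x * k x \<partial>lborel)"
  have est: "norm I \<le> h * (2 * (L2_norm g * L2_norm k))" if h: "h > 0" for h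
  proof -
    define F where "F s = (\<integral>x. q (x + h *\<^sub>R v) * g (x + s *\<^sub>R v) \<partial>lborel) + (\<integral>x. p x * k (x + s *\<^sub>R v) \<partial>lborel)" for s
    have qh: "(\<lambda>x. q (x + h *\<^sub>R v)) \<in> L2" by (rule L2_translate[OF q])
    have ph: "(\<lambda>x. p (x + h *\<^sub>R v)) \<in> L2" by (rule L2_translate[OF p])
    note int1 = line_integral_mult_integrable(3)[OF qh g, of h v]
      and int2 = line_integral_mult_integrable(3)[OF p k, of h v]
    have intF: "integrable lborel (\<lambda>s. indicat_real {0..h} s *\<^sub>R F s)"
      unfolding F_def scaleR_add_right using int1 int2 by (rule Bochner_Integration.integrable_add)
    have "(\<integral>s. indicat_real {0..h} s *\<^sub>R F s \<partial>lborel)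
        = (\<integral>x. q (x + h *\<^sub>R v) * (p (x + h *\<^sub>R v) - p x) \<partial>lborel) + (\<integral>x. p x * (q (x + h *\<^sub>R v) - q x) \<partial>lborel)"
      unfolding integral_mult_increment[OF wp p g less_imp_le[OF h] qh]
        integral_mult_increment[OF wq q k less_imp_le[OF h] p] F_def scaleR_add_right
      using int1 int2 by (rule Bochner_Integration.integral_add)
    also have "\<dots> = (\<integral>x. q (x + h *\<^sub>R v) * p (x + h *\<^sub>R v) \<partial>lborel) - (\<integral>x. q x * p x \<partial>lborel)"
      using L2_mult_integrable[OF qh ph] L2_mult_integrable[OF qh p] L2_mult_integrable[OF p qh] L2_mult_integrable[OF q p]
      by (simp add: right_diff_distrib mult.commute[of "p _"])
    also have "\<dots> = 0"
      using lborel_integral_translate[of "\<lambda>x. q x * p x" "h *\<^sub>R v"] by simp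
    finally have F0: "(\<integral>s. indicat_real {0..h} s *\<^sub>R F s \<partial>lborel) = 0" .
    have bound: "norm (I - F s) \<le> h * (2 * (L2_norm g * L2_norm k))" if s: "s \<in> {0..h}" for s
    proof -
      let ?g = "\<lambda>x. g (x + s *\<^sub>R v)" and ?k = "\<lambda>x. k (x + s *\<^sub>R v)"
      let ?q = "\<lambda>x. q (x + s *\<^sub>R v)" and ?p = "\<lambda>x. p (x + s *\<^sub>R v)"
      have L: "?g \<in> L2" "?k \<in> L2" "?q \<in> L2" "?p \<in> L2" by (intro L2_translate p q g k)+
      have dq: "L2_norm (\<lambda>x. ?q x - q (x + h *\<^sub>R v)) \<le> h * L2_norm k"
      proof -
        have "L2_norm (\<lambda>x. ?q x - q (x + h *\<^sub>R v)) = L2_norm (\<lambda>x. q ((x + s *\<^sub>R v) + (h - s) *\<^sub>R v) - q (x + s *\<^sub>R v))"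
          by (simp add: L2_norm_def norm_minus_commute algebra_simps)
        also have "\<dots> = L2_norm (\<lambda>x. q (x + (h - s) *\<^sub>R v) - q x)"
          by (rule L2_norm_translate[of "\<lambda>x. q (x + (h - s) *\<^sub>R v) - q x"]) (intro L2_diff L2_translate q)
        also have "\<dots> \<le> (h - s) * L2_norm k"
          by (rule L2_norm_increment_le[OF wq q k]) (use s in simp)
        also have "\<dots> \<le> h * L2_norm k" using s by (intro mult_right_mono) auto
        finally show ?thesis .
      qed
      have dp: "L2_norm (\<lambda>x. ?p x - p x) \<le> h * L2_norm g"
      proof -
        have "L2_norm (\<lambda>x. ?p x - p x) \<le> s * L2_norm g"
          by (rule L2_norm_increment_le[OF wp p g]) (use s in simp)
        also have "\<dots> \<le> h * L2_norm g" using s by (intro mult_right_mono) auto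
        finally show ?thesis .
      qed
      have "I - F s = ((\<integral>x. ?q x * ?g x \<partial>lborel) - (\<integral>x. q (x + h *\<^sub>R v) * ?g x \<partial>lborel))
          + ((\<integral>x. ?p x * ?k x \<partial>lborel) - (\<integral>x. p x * ?k x \<partial>lborel))"
        using lborel_integral_translate[of "\<lambda>x. q x * g x" "s *\<^sub>R v"] lborel_integral_translate[of "\<lambda>x. p x * k x" "s *\<^sub>R v"]
        by (simp add: I_def F_def)
      also have "\<dots> = (\<integral>x. (?q x - q (x + h *\<^sub>R v)) * ?g x \<partial>lborel) + (\<integral>x. (?p x - p x) * ?k x \<partial>lborel)"
        using L qh p by (simp add: left_diff_distrib L2_mult_integrable)
      finally have "norm (I - F s) \<le> norm (\<integral>x. (?q x - q (x + h *\<^sub>R v)) * ?g x \<partial>lborel) + norm (\<integral>x. (?p x - p x) * ?k x \<partial>lborel)"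
        by (simp only: norm_triangle_ineq)
      also have "\<dots> \<le> L2_norm (\<lambda>x. ?q x - q (x + h *\<^sub>R v)) * L2_norm ?g + L2_norm (\<lambda>x. ?p x - p x) * L2_norm ?k"
        using L qh p by (intro add_mono L2_norm_integral_mult_le L2_diff)
      also have "\<dots> \<le> (h * L2_norm k) * L2_norm g + (h * L2_norm g) * L2_norm k"
        unfolding L2_norm_translate[OF g] L2_norm_translate[OF k]
        by (intro add_mono mult_right_mono dq dp) auto
      finally show ?thesis by (simp add: algebra_simps)
    qed
    have intI: "integrable lborel (\<lambda>s. indicat_real {0..h} s *\<^sub>R I)"
      by (intro integrable_scaleR_left integrable_indicator_Icc)
    have "h * norm I = norm (\<integral>s. indicat_real {0..h} s *\<^sub>R (I - F s) \<partial>lborel)"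
      unfolding scaleR_diff_right using intI intF F0 h by (simp add: integral_scaleR_left)
    also have "\<dots> \<le> h * (h * (2 * (L2_norm g * L2_norm k)))"
      using intI intF by (intro integral_indicator_scaleR_bound bound) (use h in \<open>auto simp: scaleR_diff_right\<close>)
    finally show ?thesis using h by simp
  qed
  have "I = 0"
  proof (rule ccontr)
    assume "I \<noteq> 0"
    define C where "C = 2 * (L2_norm g * L2_norm k)"
    have C: "C \<ge> 0" by (simp add: C_def)
    \<comment> \<open>This choice of \<open>h\<close> makes the right-hand side of \<open>est\<close> smaller than \<open>norm I\<close>.\<close>
    have "norm I \<le> norm I / (2 * (C + 1)) * C"
      using est[of "norm I / (2 * (C + 1))"] \<open>I \<noteq> 0\<close> C by (simp add: C_def[symmetric])
    also have "\<dots> = norm I * (C / (2 * (C + 1)))" by simp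
    also have "\<dots> < norm I * 1"
      using \<open>I \<noteq> 0\<close> C by (intro mult_strict_left_mono) (auto simp: field_simps)
    finally show False by simp
  qed
  then show ?thesis by (simp add: I_def mult.commute[of "q _"] eq_neg_iff_add_eq_0)
qed

lemma has_weak_deriv_cnj:
  assumes "has_weak_deriv b f g"
  shows "has_weak_deriv b (\<lambda>x. cnj (f x)) (\<lambda>x. cnj (g x))"
proof -
  have l: "locally_integrable (\<lambda>x. cnj (F x))" if "locally_integrable F" for F :: "'a \<Rightarrow> complex"
    unfolding locally_integrable_def set_integrable_def
  proof (intro allI impI)
    fix K :: "'a set" assume "compact K"
    then have "integrable lborel (\<lambda>x. indicat_real K x *\<^sub>R F x)"
      using that by (simp add: locally_integrable_def set_integrable_def)
    from integrable_cnj[OF this]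
    show "integrable lborel (\<lambda>x. indicat_real K x *\<^sub>R cnj (F x))" by simp
  qed
  have c: "(\<integral>x. r x *\<^sub>R cnj (F x) \<partial>lborel) = cnj (\<integral>x. r x *\<^sub>R F x \<partial>lborel)" for r and F :: "'a \<Rightarrow> complex"
    by (simp add: Bochner_Integration.integral_cnj[symmetric] del: Bochner_Integration.integral_cnj)
  show ?thesis
    using assms by (simp add: has_weak_deriv_def c l)
qed

lemma L2_inner_by_parts:
  assumes wp: "has_weak_deriv v p g" and p: "p \<in> L2" and g: "g \<in> L2"
    and wq: "has_weak_deriv v q k" and q: "q \<in> L2" and k: "k \<in> L2"
  shows "L2_inner g q = - L2_inner p k"
proof -
  have re: "L2_inner f f' = Re (\<integral>x. f x * cnj (f' x) \<partial>lborel)" if "f \<in> L2" "f' \<in> L2" for f f' :: "'a \<Rightarrow> complex"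
    using L2_mult_integrable[OF that(1) L2_cnj[OF that(2)]]
    by (simp add: L2_inner_def inner_complex_def integral_Re[symmetric])
  show ?thesis
    using integration_by_parts[OF wp p g has_weak_deriv_cnj[OF wq] L2_cnj[OF q] L2_cnj[OF k]] p q g k
    by (simp add: re)
qed

section \<open>The Dirichlet integral\<close>

definition gradient_energy :: "('a::euclidean_space \<Rightarrow> complex) \<Rightarrow> real" where
  "gradient_energy f = (\<Sum>b\<in>Basis. (L2_norm (weak_deriv b f))\<^sup>2)"

lemma green_identity:
  assumes f: "f \<in> H2" and g: "g \<in> H1"
  shows "L2_inner (laplacian f) g = - (\<Sum>b\<in>Basis. L2_inner (weak_deriv b f) (weak_deriv b g))"
proof -
  have "L2_inner (laplacian f) g = (\<Sum>b\<in>Basis. L2_inner (weak_deriv b (weak_deriv b f)) g)"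
    unfolding laplacian_def[abs_def] using f g
    by (intro L2_inner_sum_left) (auto intro: weak_deriv_L2 H2_weak_deriv_H1 H1_imp_L2)
  also have "\<dots> = (\<Sum>b\<in>Basis. - L2_inner (weak_deriv b f) (weak_deriv b g))"
  proof (rule sum.cong[OF refl])
    fix b :: 'a assume b: "b \<in> Basis"
    show "L2_inner (weak_deriv b (weak_deriv b f)) g = - L2_inner (weak_deriv b f) (weak_deriv b g)"
      by (rule L2_inner_by_parts[where v = b])
         (use f g b in \<open>auto intro: weak_deriv_L2 H2_weak_deriv_H1 H1_imp_L2 H2_imp_H1 H1_has_weak_deriv\<close>)
  qed
  finally show ?thesis by (simp add: sum_negf)
qed

text \<open>
  Multiplication by \<open>c\<close> commutes with integration by parts, so the imaginary part
  of \<open>c\<close> meets the inner product of a gradient with itself and drops out.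
\<close>

lemma L2_inner_rotated_laplacian:
  assumes f: "f \<in> H2"
  shows "L2_inner (\<lambda>x. c * laplacian f x) f = - Re c * (\<Sum>b\<in>Basis. (L2_norm (weak_deriv b f))\<^sup>2)"
proof -
  have "L2_inner (\<lambda>x. c * laplacian f x) f = (\<Sum>b\<in>Basis. L2_inner (\<lambda>x. c * weak_deriv b (weak_deriv b f) x) f)"
    unfolding laplacian_def[abs_def] sum_distrib_left using f
    by (intro L2_inner_sum_left) (auto intro: L2_scale weak_deriv_L2 H2_weak_deriv_H1 H1_imp_L2 H2_imp_H1)
  also have "\<dots> = (\<Sum>b\<in>Basis. - L2_inner (\<lambda>x. c * weak_deriv b f x) (weak_deriv b f))"
  proof (rule sum.cong[OF refl])
    fix b :: 'a assume b: "b \<in> Basis"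
    show "L2_inner (\<lambda>x. c * weak_deriv b (weak_deriv b f) x) f = - L2_inner (\<lambda>x. c * weak_deriv b f x) (weak_deriv b f)"
      by (rule L2_inner_by_parts[where v = b])
         (use f b in \<open>auto intro: L2_scale has_weak_deriv_scale weak_deriv_L2 H2_weak_deriv_H1 H1_imp_L2 H2_imp_H1 H1_has_weak_deriv\<close>)
  qed
  finally show ?thesis by (simp add: L2_inner_rotate sum_negf sum_distrib_left)
qed

text \<open>
  The polarised difference of two squares; the mixed terms cancel because the Laplacian is
  symmetric.
\<close>

lemma gradient_energy_diff:
  assumes f: "f \<in> H2" and g: "g \<in> H2"
  shows "gradient_energy f - gradient_energy g
    = L2_inner (\<lambda>x. - 1 * (laplacian f x + laplacian g x)) (\<lambda>x. f x - g x)"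
proof -
  have L: "f \<in> L2" "g \<in> L2" "laplacian f \<in> L2" "laplacian g \<in> L2"
    using f g by (auto intro: laplacian_L2 H1_imp_L2 H2_imp_H1)
  have e: "gradient_energy h = - L2_inner (laplacian h) h" if "h \<in> H2" for h :: "'a \<Rightarrow> complex"
    using green_identity[OF that H2_imp_H1[OF that]] by (simp add: gradient_energy_def L2_norm_eq_inner)
  have sym: "L2_inner (laplacian f) g = L2_inner (laplacian g) f"
    using green_identity[OF f H2_imp_H1[OF g]] green_identity[OF g H2_imp_H1[OF f]]
    by (simp add: L2_inner_commute)
  have "L2_inner (\<lambda>x. - 1 * (laplacian f x + laplacian g x)) (\<lambda>x. f x - g x)
      = - L2_inner (\<lambda>x. laplacian f x + laplacian g x) (\<lambda>x. f x - g x)"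
    using L2_inner_scaleR_left[of "- 1" "\<lambda>x. laplacian f x + laplacian g x"] by simp
  then show ?thesis
    using L sym by (simp add: e[OF f] e[OF g] L2_inner_add_left L2_inner_diff_right L2_diff L2_add)
qed

lemma gradient_energy_tendsto:
  fixes f :: "'a::euclidean_space \<Rightarrow> complex"
  assumes u: "\<forall>\<^sub>F s in F. u s \<in> H1" and f: "f \<in> H1"
    and lim: "((\<lambda>s. H1_norm (\<lambda>x. u s x - f x)) \<longlongrightarrow> 0) F"
  shows "((\<lambda>s. gradient_energy (u s)) \<longlongrightarrow> gradient_energy f) F"
  unfolding gradient_energy_def L2_norm_eq_inner
proof (rule tendsto_sum)
  fix b :: 'a assume b: "b \<in> Basis"
  have L: "\<forall>\<^sub>F s in F. weak_deriv b (u s) \<in> L2"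
    using u by eventually_elim (rule weak_deriv_L2[OF _ b])
  have "\<forall>\<^sub>F s in F. norm (L2_norm (\<lambda>x. weak_deriv b (u s) x - weak_deriv b f x)) \<le> H1_norm (\<lambda>x. u s x - f x)"
    using u
  proof eventually_elim
    case (elim s)
    have "L2_norm (\<lambda>x. weak_deriv b (u s) x - weak_deriv b f x) = L2_norm (weak_deriv b (\<lambda>x. u s x - f x))"
      using weak_deriv_diff[OF elim f b] elim f b
      by (intro L2_norm_AE_cong L2_diff weak_deriv_L2 H1_diff) auto
    then show ?case using H1_norm_ge(2)[OF b, of "\<lambda>x. u s x - f x"] by simp
  qed
  from Lim_null_comparison[OF this lim]
  have "((\<lambda>s. L2_norm (\<lambda>x. weak_deriv b (u s) x - weak_deriv b f x)) \<longlongrightarrow> 0) F" .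
  then show "((\<lambda>s. L2_inner (weak_deriv b (u s)) (weak_deriv b (u s))) \<longlongrightarrow>
      L2_inner (weak_deriv b f) (weak_deriv b f)) F"
    using weak_deriv_L2[OF f b] by (intro L2_inner_tendsto[OF L L])
qed

section \<open>The power nonlinearity and its potential\<close>

lemma powr_mean_value_bound:
  fixes \<alpha> R :: real
  assumes \<alpha>: "\<alpha> > 0" and x: "0 \<le> x" "x \<le> R" and z: "0 \<le> z" "z \<le> R"
  shows "\<bar>z powr (\<alpha> + 1) - x powr (\<alpha> + 1)\<bar> \<le> (\<alpha> + 1) * R powr \<alpha> * \<bar>z - x\<bar>"
proof -
  have *: "q powr (\<alpha> + 1) - p powr (\<alpha> + 1) \<le> (\<alpha> + 1) * R powr \<alpha> * (q - p)"
    if pq: "0 \<le> p" "p < q" "q \<le> R" for p q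
  proof -
    obtain \<xi> where \<xi>: "\<xi> \<in> {p<..<q}"
      "q powr (\<alpha> + 1) - p powr (\<alpha> + 1) = (q - p) * ((\<alpha> + 1) * \<xi> powr \<alpha>)"
    proof (rule mvt[OF pq(2)])
      show "continuous_on {p..q} (\<lambda>t. t powr (\<alpha> + 1))"
        using pq \<alpha> by (intro continuous_on_powr' continuous_intros) auto
      show "((\<lambda>t. t powr (\<alpha> + 1)) has_derivative (\<lambda>h. h * ((\<alpha> + 1) * \<xi> powr \<alpha>))) (at \<xi>)"
        if "p < \<xi>" "\<xi> < q" for \<xi>
        using has_real_derivative_powr[of \<xi> "\<alpha> + 1"] that pq
        by (simp add: has_field_derivative_def mult_commute_abs)
    qed auto
    have "\<xi> powr \<alpha> \<le> R powr \<alpha>" using \<xi>(1) pq \<alpha> by (intro powr_mono2) auto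
    then show ?thesis unfolding \<xi>(2) using pq \<alpha> by (simp add: mult_left_mono mult.commute)
  qed
  have mono: "p powr (\<alpha> + 1) \<le> q powr (\<alpha> + 1)" if "0 \<le> p" "p < q" for p q :: real
    using that \<alpha> by (intro powr_mono2) auto
  show ?thesis
  proof (cases x z rule: linorder_cases)
    case less then show ?thesis using *[of x z] mono[of x z] x z by simp
  next
    case greater
    then show ?thesis using *[of z x] mono[of z x] x z by (simp add: abs_if)
  qed simp
qed

text \<open>
  The second derivative of \<open>t powr (\<alpha> + 2)\<close> as a function of
  \<open>t\<^sup>2\<close> may be unbounded near \<open>0\<close>. One application of the mean
  value theorem leaves a factor \<open>z (z powr \<alpha> - x powr \<alpha>)\<close>; it is at
  most \<open>z powr (\<alpha> + 1) - x powr (\<alpha> + 1)\<close> in absolute value, and that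
  difference is Lipschitz in \<open>z\<close>.
\<close>

lemma powr_quadratic_remainder:
  fixes \<alpha> R :: real
  assumes \<alpha>: "\<alpha> > 0" and x: "0 \<le> x" "x \<le> R" and y: "0 \<le> y" "y \<le> R"
  shows "\<bar>y powr (\<alpha> + 2) - x powr (\<alpha> + 2) - (\<alpha> + 2) / 2 * x powr \<alpha> * (y\<^sup>2 - x\<^sup>2)\<bar>
    \<le> (\<alpha> + 2) * (\<alpha> + 1) * R powr \<alpha> * (y - x)\<^sup>2"
proof -
  define f where "f t = t powr (\<alpha> + 2) - (\<alpha> + 2) / 2 * x powr \<alpha> * t\<^sup>2" for t
  have incr: "\<bar>f q - f p\<bar> \<le> (\<alpha> + 2) * (\<alpha> + 1) * R powr \<alpha> * (q - p)\<^sup>2"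
    if pq: "0 \<le> p" "p < q" "q \<le> R" "x = p \<or> x = q" for p q
  proof -
    obtain z where z: "z \<in> {p<..<q}"
      "f q - f p = (q - p) * ((\<alpha> + 2) * (z * (z powr \<alpha> - x powr \<alpha>)))"
    proof (rule mvt[OF pq(2)])
      show "continuous_on {p..q} f"
        unfolding f_def using pq \<alpha> by (intro continuous_on_powr' continuous_intros) auto
      fix z assume z: "p < z" "z < q"
      then have "(f has_real_derivative ((\<alpha> + 2) * (z * (z powr \<alpha> - x powr \<alpha>)))) (at z)"
        unfolding f_def using pq
        by (auto intro!: derivative_eq_intros simp: powr_add powr_diff field_simps power2_eq_square)
      then show "(f has_derivative (\<lambda>h. h * ((\<alpha> + 2) * (z * (z powr \<alpha> - x powr \<alpha>))))) (at z)"
        by (simp add: has_field_derivative_def mult_commute_abs)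
    qed auto
    have zpos: "z > 0" "z \<le> R" using z(1) pq by auto
    have "\<bar>z * (z powr \<alpha> - x powr \<alpha>)\<bar> \<le> \<bar>z powr (\<alpha> + 1) - x powr (\<alpha> + 1)\<bar>"
    proof -
      have e: "t powr (\<alpha> + 1) = t * t powr \<alpha>" if "t \<ge> 0" for t :: real
        using that by (cases "t = 0") (auto simp: powr_add)
      show ?thesis
      proof (cases "z \<ge> x")
        case True
        then have "x powr \<alpha> \<le> z powr \<alpha>" using x \<alpha> by (intro powr_mono2) auto
        moreover have "x * x powr \<alpha> \<le> z * x powr \<alpha>" using True by (intro mult_right_mono) auto
        ultimately show ?thesis using zpos x by (simp add: e abs_mult right_diff_distrib)
      next
        case False
        then have "z powr \<alpha> \<le> x powr \<alpha>" using zpos \<alpha> by (intro powr_mono2) auto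
        moreover have "z * x powr \<alpha> \<le> x * x powr \<alpha>" using False by (intro mult_right_mono) auto
        moreover from calculation have "z * z powr \<alpha> \<le> z * x powr \<alpha>"
          using zpos by (intro mult_left_mono) auto
        ultimately show ?thesis using zpos x by (simp add: e abs_mult right_diff_distrib)
      qed
    qed
    also have "\<dots> \<le> (\<alpha> + 1) * R powr \<alpha> * \<bar>z - x\<bar>"
      by (rule powr_mean_value_bound[OF \<alpha> x]) (use zpos in auto)
    also have "\<dots> \<le> (\<alpha> + 1) * R powr \<alpha> * (q - p)"
      using z(1) pq \<alpha> by (intro mult_left_mono) auto
    finally have b: "\<bar>z * (z powr \<alpha> - x powr \<alpha>)\<bar> \<le> (\<alpha> + 1) * R powr \<alpha> * (q - p)" .
    have "\<bar>f q - f p\<bar> = (q - p) * ((\<alpha> + 2) * \<bar>z * (z powr \<alpha> - x powr \<alpha>)\<bar>)"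
      unfolding z(2) abs_mult using pq \<alpha> by simp
    also have "\<dots> \<le> (q - p) * ((\<alpha> + 2) * ((\<alpha> + 1) * R powr \<alpha> * (q - p)))"
      using b pq \<alpha> by (intro mult_left_mono) auto
    finally show ?thesis by (simp add: power2_eq_square algebra_simps)
  qed
  have "\<bar>f y - f x\<bar> \<le> (\<alpha> + 2) * (\<alpha> + 1) * R powr \<alpha> * (y - x)\<^sup>2"
  proof (cases x y rule: linorder_cases)
    case less then show ?thesis using incr[of x y] x y by simp
  next
    case greater
    then show ?thesis using incr[of y x] x y by (simp add: abs_minus_commute power2_commute)
  qed simp
  also have "f y - f x = y powr (\<alpha> + 2) - x powr (\<alpha> + 2) - (\<alpha> + 2) / 2 * x powr \<alpha> * (y\<^sup>2 - x\<^sup>2)"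
    unfolding f_def right_diff_distrib by simp
  finally show ?thesis .
qed

text \<open>
  Writing the inner product \<open>a \<bullet> (c - a)\<close> through the squared norms of
  \<open>a\<close>, \<open>c\<close> and \<open>c - a\<close> reduces the estimate to the
  moduli, up to a term that is already quadratic in \<open>c - a\<close>.
\<close>

lemma complex_powr_quadratic_remainder:
  fixes a c :: complex
  assumes \<alpha>: "\<alpha> > 0" and a: "norm a \<le> R" and c: "norm c \<le> R"
  shows "\<bar>norm c powr (\<alpha> + 2) - norm a powr (\<alpha> + 2)
        - (\<alpha> + 2) * ((complex_of_real (norm a powr \<alpha>) * a) \<bullet> (c - a))\<bar>
    \<le> (\<alpha> + 2) * (\<alpha> + 2) * R powr \<alpha> * (norm (c - a))\<^sup>2"
proof -
  define S where "S = norm c powr (\<alpha> + 2) - norm a powr (\<alpha> + 2)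
      - (\<alpha> + 2) / 2 * norm a powr \<alpha> * ((norm c)\<^sup>2 - (norm a)\<^sup>2)"
  have "(complex_of_real (norm a powr \<alpha>) * a) \<bullet> (c - a) = norm a powr \<alpha> * (a \<bullet> (c - a))"
    by (simp add: scaleR_conv_of_real[symmetric])
  also have "a \<bullet> (c - a) = ((norm c)\<^sup>2 - (norm a)\<^sup>2 - (norm (c - a))\<^sup>2) / 2"
    by (simp add: power2_norm_eq_inner inner_diff_left inner_diff_right inner_commute)
  finally have ip: "(complex_of_real (norm a powr \<alpha>) * a) \<bullet> (c - a)
      = norm a powr \<alpha> * (((norm c)\<^sup>2 - (norm a)\<^sup>2 - (norm (c - a))\<^sup>2) / 2)" .
  have eq: "norm c powr (\<alpha> + 2) - norm a powr (\<alpha> + 2)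
        - (\<alpha> + 2) * ((complex_of_real (norm a powr \<alpha>) * a) \<bullet> (c - a))
      = S + (\<alpha> + 2) / 2 * norm a powr \<alpha> * (norm (c - a))\<^sup>2"
    unfolding ip S_def by (simp add: field_simps)
  have R: "R \<ge> 0" using norm_ge_zero[of a] a by linarith
  have "\<bar>S\<bar> \<le> (\<alpha> + 2) * (\<alpha> + 1) * R powr \<alpha> * (norm c - norm a)\<^sup>2"
    unfolding S_def using powr_quadratic_remainder[OF \<alpha> norm_ge_zero a norm_ge_zero c] by simp
  also have "\<dots> \<le> (\<alpha> + 2) * (\<alpha> + 1) * R powr \<alpha> * (norm (c - a))\<^sup>2"
    using \<alpha> norm_triangle_ineq3[of c a] by (intro mult_left_mono abs_le_square_iff[THEN iffD1]) auto
  finally have 1: "\<bar>S\<bar> \<le> (\<alpha> + 2) * (\<alpha> + 1) * R powr \<alpha> * (norm (c - a))\<^sup>2" .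
  have "(\<alpha> + 2) / 2 * norm a powr \<alpha> * (norm (c - a))\<^sup>2 \<le> (\<alpha> + 2) * R powr \<alpha> * (norm (c - a))\<^sup>2"
    using \<alpha> a powr_mono2[of \<alpha> "norm a" R] by (intro mult_right_mono mult_mono) auto
  moreover have "0 \<le> (\<alpha> + 2) / 2 * norm a powr \<alpha> * (norm (c - a))\<^sup>2" using \<alpha> by simp
  ultimately have "\<bar>S + (\<alpha> + 2) / 2 * norm a powr \<alpha> * (norm (c - a))\<^sup>2\<bar>
      \<le> (\<alpha> + 2) * (\<alpha> + 1) * R powr \<alpha> * (norm (c - a))\<^sup>2 + (\<alpha> + 2) * R powr \<alpha> * (norm (c - a))\<^sup>2"
    using 1 by linarith
  then show ?thesis unfolding eq by (simp add: algebra_simps)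
qed

definition power_nl :: "real \<Rightarrow> ('a \<Rightarrow> complex) \<Rightarrow> 'a \<Rightarrow> complex" where
  "power_nl \<alpha> f x = complex_of_real (norm (f x) powr \<alpha>) * f x"

lemma C0_norm_le_sup:
  assumes "f \<in> C0"
  shows "norm (f x) \<le> sup_norm f"
proof -
  have cont: "continuous_on UNIV f" and lim: "(f \<longlongrightarrow> 0) at_infinity" using assms by (auto simp: C0_def)
  obtain B where B: "\<And>x. B \<le> norm x \<Longrightarrow> norm (f x) < 1"
    using tendstoD[OF lim zero_less_one] by (auto simp: eventually_at_infinity)
  obtain C where C: "\<And>x. x \<in> cball 0 B \<Longrightarrow> norm (f x) \<le> C"
    using compact_continuous_image[OF continuous_on_subset[OF cont subset_UNIV] compact_cball, THEN compact_imp_bounded]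
    unfolding bounded_iff by blast
  have "norm (f y) \<le> max 1 C" for y
    using B[of y] C[of y] by (cases "B \<le> norm y") auto
  then have "bdd_above (range (\<lambda>x. norm (f x)))" by (intro bdd_aboveI[of _ "max 1 C"]) auto
  then show ?thesis unfolding sup_norm_def by (intro cSUP_upper) auto
qed

lemma C0_sup_norm_nonneg: "f \<in> C0 \<Longrightarrow> 0 \<le> sup_norm f"
  using C0_norm_le_sup[of f 0] norm_ge_zero[of "f 0"] by linarith

lemma C0_diff: "f \<in> C0 \<Longrightarrow> g \<in> C0 \<Longrightarrow> (\<lambda>x. f x - g x) \<in> C0"
  using tendsto_diff[of f 0 at_infinity g 0] by (auto simp: C0_def intro: continuous_intros)

lemma powr_integrable:
  assumes \<alpha>: "\<alpha> > 0" and f: "f \<in> L2" and R: "\<And>x. norm (f x) \<le> R"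
  shows "integrable lborel (\<lambda>x. norm (f x) powr (\<alpha> + 2))"
proof (rule Bochner_Integration.integrable_bound)
  show "integrable lborel (\<lambda>x. R powr \<alpha> * (norm (f x))\<^sup>2)" using f by (simp add: L2_integrable_square)
  have "norm (f x) powr (\<alpha> + 2) = norm (f x) powr \<alpha> * (norm (f x))\<^sup>2" for x
    by (cases "f x = 0") (auto simp: powr_add)
  then show "AE x in lborel. norm (norm (f x) powr (\<alpha> + 2)) \<le> norm (R powr \<alpha> * (norm (f x))\<^sup>2)"
    using R \<alpha> by (auto intro!: mult_right_mono powr_mono2)
qed (use L2_measurable[OF f] in measurable)

lemma power_nl_L2:
  assumes \<alpha>: "\<alpha> > 0" and f: "f \<in> L2" and R: "\<And>x. norm (f x) \<le> R"
  shows "power_nl \<alpha> f \<in> L2"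
proof (rule L2_bound)
  show "integrable lborel (\<lambda>x. (R powr \<alpha>)\<^sup>2 * (norm (f x))\<^sup>2)" using f by (simp add: L2_integrable_square)
  show "power_nl \<alpha> f \<in> borel_measurable borel"
    unfolding power_nl_def[abs_def] using L2_measurable[OF f] by measurable
  show "(norm (power_nl \<alpha> f x))\<^sup>2 \<le> (R powr \<alpha>)\<^sup>2 * (norm (f x))\<^sup>2" for x
    using R[of x] \<alpha> by (auto simp: power_nl_def norm_mult power_mult_distrib intro!: mult_right_mono power_mono powr_mono2)
qed

definition potential :: "real \<Rightarrow> ('a::euclidean_space \<Rightarrow> complex) \<Rightarrow> real" where
  "potential \<alpha> f = (\<integral>x. norm (f x) powr (\<alpha> + 2) \<partial>lborel)"

lemma potential_quadratic_remainder:
  assumes \<alpha>: "\<alpha> > 0" and f: "f \<in> L2" and fR: "\<And>x. norm (f x) \<le> R"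
    and g: "g \<in> L2" and gR: "\<And>x. norm (g x) \<le> R"
  shows "\<bar>potential \<alpha> g - potential \<alpha> f
        - (\<alpha> + 2) * L2_inner (power_nl \<alpha> f) (\<lambda>x. g x - f x)\<bar>
    \<le> (\<alpha> + 2) * (\<alpha> + 2) * R powr \<alpha> * (L2_norm (\<lambda>x. g x - f x))\<^sup>2"
proof -
  note d = L2_diff[OF g f]
  note ints = powr_integrable[OF \<alpha> f fR] powr_integrable[OF \<alpha> g gR]
    L2_inner_integrable[OF power_nl_L2[OF \<alpha> f fR] d]
  let ?r = "\<lambda>x. norm (g x) powr (\<alpha> + 2) - norm (f x) powr (\<alpha> + 2) - (\<alpha> + 2) * (power_nl \<alpha> f x \<bullet> (g x - f x))"
  have "norm (\<integral>x. ?r x \<partial>lborel) \<le> (\<integral>x. (\<alpha> + 2) * (\<alpha> + 2) * R powr \<alpha> * (norm (g x - f x))\<^sup>2 \<partial>lborel)"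
  proof (rule Bochner_Integration.integral_norm_bound_integral)
    show "integrable lborel ?r" using ints by simp
    show "integrable lborel (\<lambda>x. (\<alpha> + 2) * (\<alpha> + 2) * R powr \<alpha> * (norm (g x - f x))\<^sup>2)"
      using L2_integrable_square[OF d] by simp
    show "norm (?r x) \<le> (\<alpha> + 2) * (\<alpha> + 2) * R powr \<alpha> * (norm (g x - f x))\<^sup>2" for x
      using complex_powr_quadratic_remainder[OF \<alpha> fR gR, of x x] by (simp add: power_nl_def)
  qed
  then show ?thesis using ints by (simp add: potential_def L2_inner_def L2_norm_square)
qed

text \<open>
  Closeness in the sup norm keeps the curve in a fixed ball of
  \<open>L\<^sup>\<infinity>\<close>, which makes the constant uniform; the remainder itself is
  measured in \<open>L2\<close>, as \<open>L2_time_chain_rule\<close> requires.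
\<close>

lemma potential_remainder_eventually:
  assumes \<alpha>: "\<alpha> > 0" and f: "f \<in> L2 \<inter> C0" and u: "\<forall>\<^sub>F s in F. u s \<in> L2 \<inter> C0"
    and lim: "((\<lambda>s. sup_norm (\<lambda>x. u s x - f x)) \<longlongrightarrow> 0) F"
  obtains C where "\<forall>\<^sub>F s in F. \<bar>potential \<alpha> (u s) - potential \<alpha> f
        - (\<alpha> + 2) * L2_inner (power_nl \<alpha> f) (\<lambda>x. u s x - f x)\<bar> \<le> C * (L2_norm (\<lambda>x. u s x - f x))\<^sup>2"
proof
  define R where "R = sup_norm f + 1"
  have fR: "norm (f x) \<le> R" for x using C0_norm_le_sup[of f x] f by (simp add: R_def)
  from u order_tendstoD(2)[OF lim zero_less_one]
  show "\<forall>\<^sub>F s in F. \<bar>potential \<alpha> (u s) - potential \<alpha> f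
        - (\<alpha> + 2) * L2_inner (power_nl \<alpha> f) (\<lambda>x. u s x - f x)\<bar>
      \<le> ((\<alpha> + 2) * (\<alpha> + 2) * R powr \<alpha>) * (L2_norm (\<lambda>x. u s x - f x))\<^sup>2"
  proof eventually_elim
    case (elim s)
    have "norm (u s x) \<le> R" for x
    proof -
      have "norm (u s x - f x) \<le> 1"
        using C0_norm_le_sup[OF C0_diff, of "u s" f x] elim f by simp
      then show ?thesis
        using norm_triangle_sub[of "u s x" "f x"] C0_norm_le_sup[of f x] f by (simp add: R_def)
    qed
    then show ?case using elim f by (intro potential_quadratic_remainder \<alpha> fR) auto
  qed
qed

lemma L2_inner_rotated_power_nl:
  "L2_inner (\<lambda>x. c * power_nl \<alpha> f x) f = Re c * potential \<alpha> f"
proof -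
  have "(c * power_nl \<alpha> f x) \<bullet> f x = Re c * norm (f x) powr (\<alpha> + 2)" for x
  proof -
    have "(c * power_nl \<alpha> f x) \<bullet> f x = Re c * (norm (f x) powr \<alpha> * (f x \<bullet> f x))"
      by (simp add: power_nl_def inner_complex_def algebra_simps)
    also have "norm (f x) powr \<alpha> * (f x \<bullet> f x) = norm (f x) powr (\<alpha> + 2)"
      by (cases "f x = 0") (auto simp: powr_add power2_norm_eq_inner)
    finally show ?thesis .
  qed
  then show ?thesis by (simp add: L2_inner_def potential_def)
qed

lemma potential_tendsto:
  assumes \<alpha>: "\<alpha> > 0" and f: "f \<in> L2 \<inter> C0" and u: "\<forall>\<^sub>F s in F. u s \<in> L2 \<inter> C0"
    and sup: "((\<lambda>s. sup_norm (\<lambda>x. u s x - f x)) \<longlongrightarrow> 0) F"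
    and L2: "((\<lambda>s. L2_norm (\<lambda>x. u s x - f x)) \<longlongrightarrow> 0) F"
  shows "((\<lambda>s. potential \<alpha> (u s)) \<longlongrightarrow> potential \<alpha> f) F"
proof -
  obtain C where C: "\<forall>\<^sub>F s in F. \<bar>potential \<alpha> (u s) - potential \<alpha> f
      - (\<alpha> + 2) * L2_inner (power_nl \<alpha> f) (\<lambda>x. u s x - f x)\<bar> \<le> C * (L2_norm (\<lambda>x. u s x - f x))\<^sup>2"
    using potential_remainder_eventually[OF \<alpha> f u sup] by blast
  have N: "power_nl \<alpha> f \<in> L2" using f C0_norm_le_sup by (intro power_nl_L2[OF \<alpha>]) auto
  define K where "K = (\<alpha> + 2) * L2_norm (power_nl \<alpha> f)"
  have bound: "\<forall>\<^sub>F s in F. norm (potential \<alpha> (u s) - potential \<alpha> f)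
      \<le> K * L2_norm (\<lambda>x. u s x - f x) + C * (L2_norm (\<lambda>x. u s x - f x))\<^sup>2"
    using C u
  proof eventually_elim
    case (elim s)
    have "\<bar>L2_inner (power_nl \<alpha> f) (\<lambda>x. u s x - f x)\<bar> \<le> L2_norm (power_nl \<alpha> f) * L2_norm (\<lambda>x. u s x - f x)"
      using elim f by (intro L2_Cauchy_Schwarz N L2_diff) auto
    then have "\<bar>(\<alpha> + 2) * L2_inner (power_nl \<alpha> f) (\<lambda>x. u s x - f x)\<bar> \<le> K * L2_norm (\<lambda>x. u s x - f x)"
      using \<alpha> by (simp add: abs_mult K_def mult.assoc)
    then show ?case using elim(1) by simp
  qed
  have "((\<lambda>s. K * L2_norm (\<lambda>x. u s x - f x) + C * (L2_norm (\<lambda>x. u s x - f x))\<^sup>2) \<longlongrightarrow> K * 0 + C * 0\<^sup>2) F"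
    by (intro tendsto_intros L2)
  then have "((\<lambda>s. K * L2_norm (\<lambda>x. u s x - f x) + C * (L2_norm (\<lambda>x. u s x - f x))\<^sup>2) \<longlongrightarrow> 0) F"
    by simp
  from Lim_null_comparison[OF bound this] show ?thesis by (rule LIM_zero_cancel)
qed

section \<open>The concavity method\<close>

text \<open>
  Levine's concavity method as a statement about two real functions. The inequality
  \<open>key\<close> says that \<open>g m powr (- \<beta>)\<close> is nondecreasing, so
  \<open>g\<close> dominates a multiple of \<open>m powr \<beta>\<close>, and
  \<open>m'_ge\<close> makes \<open>m\<close> satisfy a superlinear differential inequality.
  Then \<open>m powr (1 - \<beta>)\<close> decreases at least at a fixed rate while staying
  positive, which is impossible on a half-line.
\<close>

lemma concavity_method:
  fixes m g m' g' :: "real \<Rightarrow> real"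
  assumes k: "k > 0" and \<beta>: "\<beta> > 1" and g0: "g 0 > 0"
    and g_cont: "continuous_on {0..} g"
    and dm: "\<And>t. t > 0 \<Longrightarrow> (m has_real_derivative m' t) (at t)"
    and dg: "\<And>t. t > 0 \<Longrightarrow> (g has_real_derivative g' t) (at t)"
    and m_nonneg: "\<And>t. t > 0 \<Longrightarrow> m t \<ge> 0"
    and m'_ge: "\<And>t. t > 0 \<Longrightarrow> m' t \<ge> k * g t"
    and g'_nonneg: "\<And>t. t > 0 \<Longrightarrow> g' t \<ge> 0"
    and key: "\<And>t. t > 0 \<Longrightarrow> g t > 0 \<Longrightarrow> m t * g' t \<ge> \<beta> * m' t * g t"
  shows False
proof -
  have g_pos: "g t > 0" if "t \<ge> 0" for t
  proof -
    have "g 0 \<le> g t"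
    proof (rule DERIV_nonneg_imp_increasing_open[OF that])
      show "continuous_on {0..t} g" by (rule continuous_on_subset[OF g_cont]) auto
    qed (use dg g'_nonneg in blast)
    then show ?thesis using g0 by simp
  qed
  have m'_pos: "m' t > 0" if "t > 0" for t
    using m'_ge[OF that] g_pos[of t] k that by (smt (verit) mult_pos_pos)
  have m_mono: "m s < m t" if "0 < s" "s < t" for s t
  proof (rule DERIV_pos_imp_increasing[OF that(2)])
    fix x assume "s \<le> x"
    then have "x > 0" using that by simp
    then show "\<exists>y. (m has_real_derivative y) (at x) \<and> 0 < y" using dm m'_pos by blast
  qed
  have m_pos: "m t > 0" if "t > 0" for t
    using m_mono[of "t / 2" t] m_nonneg[of "t / 2"] that by simp
  have dpow: "((\<lambda>t. m t powr e) has_real_derivative e * m s powr (e - 1) * m' s) (at s)" if "s > 0" for s e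
    using DERIV_fun_powr[OF dm[OF that] m_pos[OF that], of e] by simp
  \<comment> \<open>The argument starts at time 1, because \<open>m\<close> may vanish at time 0.\<close>
  define \<kappa> where "\<kappa> = g 1 * m 1 powr (- \<beta>)"
  have \<kappa>: "\<kappa> > 0" using g_pos[of 1] m_pos[of 1] by (simp add: \<kappa>_def)
  have g_ge: "\<kappa> \<le> g t * m t powr (- \<beta>)" if "t \<ge> 1" for t
    unfolding \<kappa>_def
  proof (rule DERIV_nonneg_imp_nondecreasing[OF that])
    fix s :: real assume "1 \<le> s"
    then have s: "s > 0" by simp
    have "((\<lambda>t. g t * m t powr (- \<beta>)) has_real_derivative
        g' s * m s powr (- \<beta>) + g s * (- \<beta> * m s powr (- \<beta> - 1) * m' s)) (at s)"
      by (rule DERIV_cong[OF DERIV_mult[OF dg[OF s] dpow[OF s]]]) simp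
    moreover have "g' s * m s powr (- \<beta>) + g s * (- \<beta> * m s powr (- \<beta> - 1) * m' s)
        = m s powr (- \<beta> - 1) * (m s * g' s - \<beta> * m' s * g s)"
      using m_pos[OF s] by (simp add: powr_diff field_simps)
    moreover have "\<dots> \<ge> 0" using key[OF s] g_pos[of s] s by simp
    ultimately show "\<exists>y. ((\<lambda>t. g t * m t powr (- \<beta>)) has_real_derivative y) (at s) \<and> 0 \<le> y"
      by metis
  qed
  define c where "c = (\<beta> - 1) * (k * \<kappa>)"
  have c: "c > 0" using \<beta> k \<kappa> by (simp add: c_def)
  have decr: "m t powr (1 - \<beta>) + c * t \<le> m 1 powr (1 - \<beta>) + c * 1" if "t \<ge> 1" for t
  proof (rule DERIV_nonpos_imp_nonincreasing[OF that])
    fix s :: real assume s1: "1 \<le> s"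
    then have s: "s > 0" by simp
    have "((\<lambda>t. m t powr (1 - \<beta>) + c * t) has_real_derivative
        (1 - \<beta>) * m s powr (- \<beta>) * m' s + c) (at s)"
      using DERIV_add[OF dpow[OF s, of "1 - \<beta>"] DERIV_cmult_Id[of c s UNIV]] by simp
    moreover have "(1 - \<beta>) * m s powr (- \<beta>) * m' s + c = (\<beta> - 1) * (k * \<kappa> - m s powr (- \<beta>) * m' s)"
      by (simp add: c_def algebra_simps)
    moreover have "k * \<kappa> \<le> m s powr (- \<beta>) * m' s"
    proof -
      have "k * \<kappa> \<le> k * (g s * m s powr (- \<beta>))" using g_ge[OF s1] k by simp
      also have "\<dots> = m s powr (- \<beta>) * (k * g s)" by simp
      also have "\<dots> \<le> m s powr (- \<beta>) * m' s" using m'_ge[OF s] by (intro mult_left_mono) auto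
      finally show ?thesis .
    qed
    then have "(\<beta> - 1) * (k * \<kappa> - m s powr (- \<beta>) * m' s) \<le> 0"
      using \<beta> by (intro mult_nonneg_nonpos) auto
    ultimately show "\<exists>y. ((\<lambda>t. m t powr (1 - \<beta>) + c * t) has_real_derivative y) (at s) \<and> y \<le> 0"
      by metis
  qed
  \<comment> \<open>By this time \<open>c * t\<close> has used up the initial value \<open>m 1 powr (1 - \<beta>)\<close>.\<close>
  define T where "T = 1 + m 1 powr (1 - \<beta>) / c"
  have "T \<ge> 1" using c by (simp add: T_def)
  have "c * T = c + m 1 powr (1 - \<beta>)" using c by (simp add: T_def field_simps)
  with decr[OF \<open>T \<ge> 1\<close>] have "m T powr (1 - \<beta>) \<le> 0" by simp
  then show False using m_pos[of T] \<open>T \<ge> 1\<close> by simp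
qed

section \<open>Mass and energy of global solutions\<close>

lemma energy_eq:
  assumes "f \<in> H1"
  shows "energy \<alpha> f = gradient_energy f / 2 - potential \<alpha> f / (\<alpha> + 2)"
proof -
  have "(\<integral>x. (\<Sum>b\<in>Basis. (norm (weak_deriv b f x))\<^sup>2) \<partial>lborel) = gradient_energy f"
    unfolding gradient_energy_def L2_norm_square
    using weak_deriv_L2[OF assms] by (intro Bochner_Integration.integral_sum L2_integrable_square)
  then show ?thesis by (simp add: energy_def potential_def)
qed

text \<open>
  Solutions on \<open>[0, \<infinity>)\<close>. Negative energy will turn out to be incompatible
  with this locale.
\<close>

locale global_solution =
  fixes \<theta> \<alpha> \<gamma> :: real
    and u0 :: "'a::euclidean_space \<Rightarrow> complex" and u :: "real \<Rightarrow> 'a \<Rightarrow> complex"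
  assumes \<theta>: "0 < cos \<theta>" and \<alpha>: "\<alpha> > 0" and \<gamma>: "\<gamma> \<ge> 0"
    and solution: "is_solution \<theta> \<alpha> \<gamma> u0 \<infinity> u"
begin

text \<open>
  The factor of \<open>cis \<theta>\<close> in the equation, which is also minus the gradient of
  the energy with respect to the \<open>L2\<close> inner product.
\<close>

definition "source t x = laplacian (u t) x + power_nl \<alpha> (u t) x"

lemma initial: "u 0 = u0"
  using solution by (simp add: is_solution_def)

lemma curve_H1_C0: "continuous_curve {0..} (H1 \<inter> C0) (\<lambda>f. H1_norm f + sup_norm f) u"
  using solution by (simp add: is_solution_def atLeast_def)

lemma curve_H2: "continuous_curve {0<..} H2 H2_norm u"
  using solution by (simp add: is_solution_def greaterThan_def)

lemma in_H1: "t \<ge> 0 \<Longrightarrow> u t \<in> H1" and in_C0: "t \<ge> 0 \<Longrightarrow> u t \<in> C0" and in_L2: "t \<ge> 0 \<Longrightarrow> u t \<in> L2"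
  using curve_H1_C0 by (auto simp: continuous_curve_def intro: H1_imp_L2)

lemma in_H2: "t > 0 \<Longrightarrow> u t \<in> H2"
  using curve_H2 by (auto simp: continuous_curve_def)

lemma power_nl_in_L2: "t \<ge> 0 \<Longrightarrow> power_nl \<alpha> (u t) \<in> L2"
  by (rule power_nl_L2[OF \<alpha> in_L2 C0_norm_le_sup[OF in_C0]])

lemma source_L2: "t > 0 \<Longrightarrow> source t \<in> L2"
  unfolding source_def[abs_def] by (intro L2_add laplacian_L2 in_H2 power_nl_in_L2) auto

lemma time_deriv:
  assumes t: "t > 0"
  obtains v where "has_L2_time_deriv u v t" "v \<in> L2"
    "AE x in lborel. v x = cis \<theta> * source t x + of_real \<gamma> * u t x"
proof -
  obtain ut where "has_L2_time_deriv u (ut t) t"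
    "AE x in lborel. ut t x = cis \<theta> * (laplacian (u t) x + of_real (norm (u t x) powr \<alpha>) * u t x) + of_real \<gamma> * u t x"
    using solution t by (auto simp: is_solution_def)
  then show ?thesis
    by (intro that[of "ut t"]) (auto simp: source_def power_nl_def has_L2_time_deriv_def)
qed

lemma H1_and_sup_tendsto:
  assumes t: "t \<ge> 0"
  shows "((\<lambda>s. H1_norm (\<lambda>x. u s x - u t x)) \<longlongrightarrow> 0) (at t within {0..})"
    and "((\<lambda>s. sup_norm (\<lambda>x. u s x - u t x)) \<longlongrightarrow> 0) (at t within {0..})"
proof -
  have lim: "((\<lambda>s. H1_norm (\<lambda>x. u s x - u t x) + sup_norm (\<lambda>x. u s x - u t x)) \<longlongrightarrow> 0) (at t within {0..})"
    using curve_H1_C0 t by (auto simp: continuous_curve_def)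
  have nn: "0 \<le> sup_norm (\<lambda>x. u s x - u t x)" if "s \<in> {0..}" for s
    using that t by (intro C0_sup_norm_nonneg C0_diff in_C0) auto
  have nnH: "0 \<le> H1_norm (\<lambda>x. u s x - u t x)" for s by (rule H1_norm_ge)
  have ev: "\<forall>\<^sub>F s in at t within {0..}. s \<in> {0..}"
    by (simp add: eventually_at_filter)
  have "\<forall>\<^sub>F s in at t within {0..}. norm (H1_norm (\<lambda>x. u s x - u t x)) \<le> H1_norm (\<lambda>x. u s x - u t x) + sup_norm (\<lambda>x. u s x - u t x)"
    using ev by eventually_elim (use nn nnH in \<open>auto simp: abs_of_nonneg\<close>)
  from Lim_null_comparison[OF this lim] show "((\<lambda>s. H1_norm (\<lambda>x. u s x - u t x)) \<longlongrightarrow> 0) (at t within {0..})" .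
  have "\<forall>\<^sub>F s in at t within {0..}. norm (sup_norm (\<lambda>x. u s x - u t x)) \<le> H1_norm (\<lambda>x. u s x - u t x) + sup_norm (\<lambda>x. u s x - u t x)"
    using ev by eventually_elim (use nn nnH in \<open>auto simp: abs_of_nonneg\<close>)
  from Lim_null_comparison[OF this lim] show "((\<lambda>s. sup_norm (\<lambda>x. u s x - u t x)) \<longlongrightarrow> 0) (at t within {0..})" .
qed

lemma L2_tendsto:
  assumes t: "t \<ge> 0"
  shows "((\<lambda>s. L2_norm (\<lambda>x. u s x - u t x)) \<longlongrightarrow> 0) (at t within {0..})"
  by (rule Lim_null_comparison[OF _ H1_and_sup_tendsto(1)[OF t]]) (auto simp: H1_norm_ge)

lemma energy_continuous: "continuous_on {0..} (\<lambda>t. energy \<alpha> (u t))"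
proof -
  have "((\<lambda>s. gradient_energy (u s) / 2 - potential \<alpha> (u s) / (\<alpha> + 2)) \<longlongrightarrow>
      gradient_energy (u t) / 2 - potential \<alpha> (u t) / (\<alpha> + 2)) (at t within {0..})" if t: "t \<ge> 0" for t
  proof -
    have ev: "\<forall>\<^sub>F s in at t within {0..}. 0 \<le> s"
      by (simp add: eventually_at_filter)
    show ?thesis
      using \<alpha> in_H1[OF t] in_C0[OF t] in_L2[OF t] t
      by (intro tendsto_intros gradient_energy_tendsto potential_tendsto H1_and_sup_tendsto L2_tendsto)
         (auto intro!: eventually_mono[OF ev] in_H1 in_C0 in_L2)
  qed
  then have "continuous_on {0..} (\<lambda>t. gradient_energy (u t) / 2 - potential \<alpha> (u t) / (\<alpha> + 2))"
    by (auto simp: continuous_on_def)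
  then show ?thesis
    by (rule continuous_on_eq) (simp add: energy_eq in_H1)
qed

lemma eventually_pos_shift: "t > 0 \<Longrightarrow> \<forall>\<^sub>F h in at 0. t + h > (0::real)"
  unfolding eventually_at by (intro exI[of _ t]) (auto simp: dist_real_def)

lemma shift_tendsto:
  fixes t :: real
  assumes "(F \<longlongrightarrow> (0::real)) (at t within S)" "t \<in> interior S"
  shows "((\<lambda>h. F (t + h)) \<longlongrightarrow> 0) (at 0)"
proof -
  have "(F \<longlongrightarrow> 0) (at t)" using assms(1) unfolding at_within_interior[OF assms(2)] .
  then show ?thesis by (rule LIM_offset_zero[of F 0 t])
qed

lemma mass_deriv:
  assumes t: "t > 0" and v: "has_L2_time_deriv u v t"
  shows "((\<lambda>t. (L2_norm (u t))\<^sup>2) has_real_derivative 2 * L2_inner (u t) v) (at t)"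
proof -
  note L = in_L2[OF less_imp_le[OF t]]
  have ev: "\<forall>\<^sub>F h in at 0. u (t + h) \<in> L2"
    using eventually_pos_shift[OF t] by eventually_elim (simp add: in_L2)
  have "((\<lambda>t. (L2_norm (u t))\<^sup>2) has_real_derivative L2_inner (\<lambda>x. 2 *\<^sub>R u t x) v) (at t)"
  proof (rule L2_time_chain_rule[OF v ev L, where A = "\<lambda>_ x. 2 *\<^sub>R u t x" and C = 1])
    show "\<forall>\<^sub>F h in at 0. \<bar>(L2_norm (u (t + h)))\<^sup>2 - (L2_norm (u t))\<^sup>2
        - L2_inner (\<lambda>x. 2 *\<^sub>R u t x) (\<lambda>x. u (t + h) x - u t x)\<bar> \<le> 1 * (L2_norm (\<lambda>x. u (t + h) x - u t x))\<^sup>2"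
      using ev
    proof eventually_elim
      case (elim h)
      have "(L2_norm (u (t + h)))\<^sup>2 - (L2_norm (u t))\<^sup>2 - L2_inner (\<lambda>x. 2 *\<^sub>R u t x) (\<lambda>x. u (t + h) x - u t x)
          = (L2_norm (\<lambda>x. u (t + h) x - u t x))\<^sup>2"
        unfolding L2_norm_eq_inner L2_inner_scaleR_left using elim L
        by (simp add: L2_inner_diff_left L2_inner_diff_right L2_diff L2_inner_commute[of "u t" "u (t + h)"])
      then show ?case by simp
    qed
  qed (auto intro: L2_scaleR L simp: L2_norm_def)
  then show ?thesis by (simp only: L2_inner_scaleR_left)
qed

lemma gradient_energy_deriv:
  assumes t: "t > 0" and v: "has_L2_time_deriv u v t"
  shows "((\<lambda>t. gradient_energy (u t)) has_real_derivative - 2 * L2_inner (laplacian (u t)) v) (at t)"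
proof -
  note L = in_L2[OF less_imp_le[OF t]] and H = in_H2[OF t]
  have evH: "\<forall>\<^sub>F h in at 0. u (t + h) \<in> H2"
    using eventually_pos_shift[OF t] by eventually_elim (simp add: in_H2)
  have ev: "\<forall>\<^sub>F h in at 0. u (t + h) \<in> L2"
    using evH by eventually_elim (auto intro: H1_imp_L2 H2_imp_H1)
  have H2_lim: "((\<lambda>h. H2_norm (\<lambda>x. u (t + h) x - u t x)) \<longlongrightarrow> 0) (at 0)"
    using curve_H2 t by (intro shift_tendsto[where S = "{0<..}"]) (auto simp: continuous_curve_def interior_open)
  have "((\<lambda>t. gradient_energy (u t)) has_real_derivative L2_inner (\<lambda>x. (- 2) *\<^sub>R laplacian (u t) x) v) (at t)"
  proof (rule L2_time_chain_rule[OF v ev L, where C = 0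
        and A = "\<lambda>h x. - 1 * (laplacian (u (t + h)) x + laplacian (u t) x)"])
    show "\<forall>\<^sub>F h in at 0. (\<lambda>x. - 1 * (laplacian (u (t + h)) x + laplacian (u t) x)) \<in> L2"
      using evH by eventually_elim (intro L2_scale L2_add laplacian_L2 H)
    show "(\<lambda>x. (- 2) *\<^sub>R laplacian (u t) x) \<in> L2" by (intro L2_scaleR laplacian_L2 H)
    show "((\<lambda>h. L2_norm (\<lambda>x. - 1 * (laplacian (u (t + h)) x + laplacian (u t) x) - (- 2) *\<^sub>R laplacian (u t) x)) \<longlongrightarrow> 0) (at 0)"
    proof (rule Lim_null_comparison)
      show "((\<lambda>h. real DIM('a) * H2_norm (\<lambda>x. u (t + h) x - u t x)) \<longlongrightarrow> 0) (at 0)"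
        using tendsto_mult_right_zero[OF H2_lim] .
      show "\<forall>\<^sub>F h in at 0. norm (L2_norm (\<lambda>x. - 1 * (laplacian (u (t + h)) x + laplacian (u t) x) - (- 2) *\<^sub>R laplacian (u t) x))
          \<le> real DIM('a) * H2_norm (\<lambda>x. u (t + h) x - u t x)"
        using evH
      proof eventually_elim
        case (elim h)
        have "- 1 * (laplacian (u (t + h)) x + laplacian (u t) x) - (- 2) *\<^sub>R laplacian (u t) x
            = - (laplacian (u (t + h)) x - laplacian (u t) x)" for x
          by (simp add: scaleR_conv_of_real)
        then have "L2_norm (\<lambda>x. - 1 * (laplacian (u (t + h)) x + laplacian (u t) x) - (- 2) *\<^sub>R laplacian (u t) x)
            = L2_norm (\<lambda>x. laplacian (u (t + h)) x - laplacian (u t) x)"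
          unfolding L2_norm_def by (simp only: norm_minus_cancel)
        then show ?case using laplacian_diff_L2_norm_le[OF elim H] by simp
      qed
    qed
    show "\<forall>\<^sub>F h in at 0. \<bar>gradient_energy (u (t + h)) - gradient_energy (u t)
        - L2_inner (\<lambda>x. - 1 * (laplacian (u (t + h)) x + laplacian (u t) x)) (\<lambda>x. u (t + h) x - u t x)\<bar>
        \<le> 0 * (L2_norm (\<lambda>x. u (t + h) x - u t x))\<^sup>2"
      using evH
    proof eventually_elim
      case (elim h)
      show ?case using gradient_energy_diff[OF elim H] by simp
    qed
  qed
  then show ?thesis by (simp only: L2_inner_scaleR_left)
qed

lemma potential_deriv:
  assumes t: "t > 0" and v: "has_L2_time_deriv u v t"
  shows "((\<lambda>t. potential \<alpha> (u t)) has_real_derivative (\<alpha> + 2) * L2_inner (power_nl \<alpha> (u t)) v) (at t)"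
proof -
  note L = in_L2[OF less_imp_le[OF t]] and C = in_C0[OF less_imp_le[OF t]]
  have ev: "\<forall>\<^sub>F h in at 0. u (t + h) \<in> L2 \<inter> C0"
    using eventually_pos_shift[OF t] by eventually_elim (simp add: in_L2 in_C0)
  have sup: "((\<lambda>h. sup_norm (\<lambda>x. u (t + h) x - u t x)) \<longlongrightarrow> 0) (at 0)"
    using H1_and_sup_tendsto(2)[of t] t by (intro shift_tendsto[where S = "{0..}"]) auto
  obtain K where K: "\<forall>\<^sub>F h in at 0. \<bar>potential \<alpha> (u (t + h)) - potential \<alpha> (u t)
      - (\<alpha> + 2) * L2_inner (power_nl \<alpha> (u t)) (\<lambda>x. u (t + h) x - u t x)\<bar> \<le> K * (L2_norm (\<lambda>x. u (t + h) x - u t x))\<^sup>2"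
    using potential_remainder_eventually[OF \<alpha> _ ev sup] L C by blast
  have N: "power_nl \<alpha> (u t) \<in> L2" using t by (intro power_nl_in_L2) simp
  have "((\<lambda>t. potential \<alpha> (u t)) has_real_derivative L2_inner (\<lambda>x. (\<alpha> + 2) *\<^sub>R power_nl \<alpha> (u t) x) v) (at t)"
  proof (rule L2_time_chain_rule[OF v _ L, where A = "\<lambda>_ x. (\<alpha> + 2) *\<^sub>R power_nl \<alpha> (u t) x" and C = K])
    show "\<forall>\<^sub>F h in at 0. u (t + h) \<in> L2" using ev by eventually_elim simp
  qed (use K in \<open>auto intro: L2_scaleR N simp: L2_norm_def L2_inner_scaleR_left\<close>)
  then show ?thesis by (simp only: L2_inner_scaleR_left)
qed

lemma source_inner_u:
  assumes t: "t > 0"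
  shows "L2_inner (\<lambda>x. c * source t x) (u t) = Re c * (potential \<alpha> (u t) - gradient_energy (u t))"
proof -
  note L = in_L2[OF less_imp_le[OF t]] and H = in_H2[OF t] and N = power_nl_in_L2[OF less_imp_le[OF t]]
  have "L2_inner (\<lambda>x. c * source t x) (u t)
      = L2_inner (\<lambda>x. c * laplacian (u t) x) (u t) + L2_inner (\<lambda>x. c * power_nl \<alpha> (u t) x) (u t)"
    unfolding source_def distrib_left using L H N by (intro L2_inner_add_left L2_scale laplacian_L2)
  then show ?thesis
    by (simp add: L2_inner_rotated_laplacian[OF H] L2_inner_rotated_power_nl gradient_energy_def
        algebra_simps)
qed

text \<open>
  Pair the equation with \<open>u\<close>. The pairing of the source with \<open>u\<close> is
  real, so \<open>cis \<theta>\<close> contributes its real part only.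
\<close>

lemma mass_identity:
  assumes t: "t > 0"
  shows "((\<lambda>t. (L2_norm (u t))\<^sup>2) has_real_derivative
    2 * (cos \<theta> * (potential \<alpha> (u t) - gradient_energy (u t)) + \<gamma> * (L2_norm (u t))\<^sup>2)) (at t)"
proof -
  note L = in_L2[OF less_imp_le[OF t]] and S = source_L2[OF t]
  obtain v where v: "has_L2_time_deriv u v t" "v \<in> L2"
    "AE x in lborel. v x = cis \<theta> * source t x + of_real \<gamma> * u t x"
    using time_deriv[OF t] .
  have "L2_inner v (u t) = L2_inner (\<lambda>x. cis \<theta> * source t x + of_real \<gamma> * u t x) (u t)"
    using v L S by (intro L2_inner_AE_cong L2_add L2_scale) auto
  also have "\<dots> = L2_inner (\<lambda>x. cis \<theta> * source t x) (u t) + L2_inner (\<lambda>x. of_real \<gamma> * u t x) (u t)"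
    using L S by (intro L2_inner_add_left L2_scale)
  finally show ?thesis
    using mass_deriv[OF t v(1)]
    by (simp add: source_inner_u[OF t] L2_inner_rotate L2_inner_commute[of "u t"])
qed

text \<open>
  The energy has derivative \<open>- L2_inner (source t) v\<close>; insert the equation for
  \<open>v\<close>.
\<close>

lemma energy_identity:
  assumes t: "t > 0"
  shows "((\<lambda>t. energy \<alpha> (u t)) has_real_derivative
    - (cos \<theta> * (L2_norm (source t))\<^sup>2) - \<gamma> * (potential \<alpha> (u t) - gradient_energy (u t))) (at t)"
proof -
  note L = in_L2[OF less_imp_le[OF t]] and S = source_L2[OF t] and H = in_H2[OF t]
    and N = power_nl_in_L2[OF less_imp_le[OF t]]
  obtain v where v: "has_L2_time_deriv u v t" "v \<in> L2"
    "AE x in lborel. v x = cis \<theta> * source t x + of_real \<gamma> * u t x"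
    using time_deriv[OF t] .
  have "L2_inner v (source t) = L2_inner (\<lambda>x. cis \<theta> * source t x + of_real \<gamma> * u t x) (source t)"
    using v L S by (intro L2_inner_AE_cong L2_add L2_scale) auto
  also have "\<dots> = L2_inner (\<lambda>x. cis \<theta> * source t x) (source t) + L2_inner (\<lambda>x. \<gamma> *\<^sub>R u t x) (source t)"
    unfolding scaleR_conv_of_real using L S by (intro L2_inner_add_left L2_scale)
  also have "\<dots> = cos \<theta> * (L2_norm (source t))\<^sup>2 + \<gamma> * (potential \<alpha> (u t) - gradient_energy (u t))"
    using source_inner_u[OF t, of 1]
    by (simp add: L2_inner_rotate L2_inner_scaleR_left L2_inner_commute[of "u t"])
  finally have vS: "L2_inner v (source t) = \<dots>" .
  have split: "L2_inner (source t) v = L2_inner (laplacian (u t)) v + L2_inner (power_nl \<alpha> (u t)) v"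
    unfolding source_def[abs_def] using N v laplacian_L2[OF H] by (intro L2_inner_add_left)
  have "((\<lambda>t. gradient_energy (u t) / 2 - potential \<alpha> (u t) / (\<alpha> + 2)) has_real_derivative
      - 2 * L2_inner (laplacian (u t)) v / 2 - (\<alpha> + 2) * L2_inner (power_nl \<alpha> (u t)) v / (\<alpha> + 2)) (at t)"
    by (intro DERIV_diff DERIV_cdivide gradient_energy_deriv potential_deriv t v(1))
  also have "- 2 * L2_inner (laplacian (u t)) v / 2 - (\<alpha> + 2) * L2_inner (power_nl \<alpha> (u t)) v / (\<alpha> + 2)
      = - L2_inner v (source t)"
    using \<alpha> split by (simp add: L2_inner_commute[of v])
  finally have "((\<lambda>t. gradient_energy (u t) / 2 - potential \<alpha> (u t) / (\<alpha> + 2)) has_real_derivative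
      - L2_inner v (source t)) (at t)" .
  then have "((\<lambda>t. energy \<alpha> (u t)) has_real_derivative - L2_inner v (source t)) (at t)"
    by (rule has_field_derivative_transform_within_open[where S = "{0<..}"])
       (use t in \<open>auto simp: energy_eq in_H1\<close>)
  then show ?thesis by (simp add: vS)
qed

text \<open>
  With the weight \<open>e t = exp (- 2 \<gamma> t)\<close>, apply
  \<open>concavity_method\<close> to \<open>m = e M\<close> and \<open>g = - e E\<close>. The
  weight absorbs the driving term: it cancels \<open>2 \<gamma> M\<close> in the mass identity,
  and in the energy identity it leaves \<open>\<gamma> (2 E + J)\<close>, a nonnegative multiple
  of the potential.
\<close>

theorem energy_nonneg: "energy \<alpha> u0 \<ge> 0"
proof (rule ccontr)
  assume "\<not> energy \<alpha> u0 \<ge> 0"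
  then have E0: "energy \<alpha> (u 0) < 0" by (simp add: initial)
  define E where "E t = energy \<alpha> (u t)" for t
  define M where "M t = (L2_norm (u t))\<^sup>2" for t
  define J where "J t = potential \<alpha> (u t) - gradient_energy (u t)" for t
  define W where "W t = (L2_norm (source t))\<^sup>2" for t
  define e where "e t = exp (- 2 * \<gamma> * t)" for t
  have e_deriv: "(e has_real_derivative - 2 * \<gamma> * e t) (at t)" for t
    unfolding e_def by (auto intro!: derivative_eq_intros)
  have e_pos: "e t > 0" for t by (simp add: e_def)
  have P: "potential \<alpha> (u t) \<ge> 0" and G: "gradient_energy (u t) \<ge> 0" for t
    by (auto simp: potential_def gradient_energy_def intro: sum_nonneg)
  have E_eq: "E t = gradient_energy (u t) / 2 - potential \<alpha> (u t) / (\<alpha> + 2)" if "t > 0" for t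
    using that by (simp add: E_def energy_eq in_H1)
  have J1: "J t + (\<alpha> + 2) * E t \<ge> 0" if "t > 0" for t
  proof -
    have "J t + (\<alpha> + 2) * E t = \<alpha> / 2 * gradient_energy (u t)"
      using \<alpha> by (simp add: J_def E_eq[OF that] field_simps)
    then show ?thesis using \<alpha> mult_nonneg_nonneg[OF _ G, of "\<alpha> / 2" t] by simp
  qed
  have J2: "2 * E t + J t \<ge> 0" if "t > 0" for t
  proof -
    have "2 * E t + J t = \<alpha> / (\<alpha> + 2) * potential \<alpha> (u t)"
      using \<alpha> by (simp add: J_def E_eq[OF that] field_simps)
    then show ?thesis using \<alpha> mult_nonneg_nonneg[OF _ P, of "\<alpha> / (\<alpha> + 2)" t] by simp
  qed
  have CS: "(J t)\<^sup>2 \<le> W t * M t" if "t > 0" for t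
  proof -
    have "\<bar>J t\<bar> \<le> L2_norm (source t) * L2_norm (u t)"
      using L2_Cauchy_Schwarz[OF source_L2[OF that] in_L2[of t]] source_inner_u[OF that, of 1] that
      by (simp add: J_def)
    then have "\<bar>J t\<bar>\<^sup>2 \<le> (L2_norm (source t) * L2_norm (u t))\<^sup>2" by (rule power_mono) simp
    then show ?thesis by (simp add: W_def M_def power_mult_distrib)
  qed
  show False
  proof (rule concavity_method[where m = "\<lambda>t. e t * M t" and g = "\<lambda>t. - (e t * E t)" and k = "2 * cos \<theta> * (\<alpha> + 2)"
        and \<beta> = "(\<alpha> + 2) / 2" and m' = "\<lambda>t. 2 * cos \<theta> * (e t * J t)"
        and g' = "\<lambda>t. e t * (cos \<theta> * W t + \<gamma> * (2 * E t + J t))"])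
    show "0 < 2 * cos \<theta> * (\<alpha> + 2)" "1 < (\<alpha> + 2) / 2" using \<theta> \<alpha> by auto
    show "0 < - (e 0 * E 0)" using E0 by (simp add: e_def E_def)
    have "continuous_on {0..} e" unfolding e_def by (intro continuous_intros)
    then show "continuous_on {0..} (\<lambda>t. - (e t * E t))"
      unfolding E_def by (intro continuous_intros energy_continuous)
    fix t :: real assume t: "t > 0"
    have dM: "(M has_real_derivative 2 * (cos \<theta> * J t + \<gamma> * M t)) (at t)"
      using mass_identity[OF t] by (simp add: M_def[abs_def] J_def)
    have dE: "(E has_real_derivative - (cos \<theta> * W t) - \<gamma> * J t) (at t)"
      using energy_identity[OF t] by (simp add: E_def[abs_def] W_def J_def)
    show "((\<lambda>t. e t * M t) has_real_derivative 2 * cos \<theta> * (e t * J t)) (at t)"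
      by (rule DERIV_cong[OF DERIV_mult[OF e_deriv dM]]) (simp add: algebra_simps)
    show "((\<lambda>t. - (e t * E t)) has_real_derivative e t * (cos \<theta> * W t + \<gamma> * (2 * E t + J t))) (at t)"
      by (rule DERIV_cong[OF DERIV_minus[OF DERIV_mult[OF e_deriv dE]]]) (simp add: algebra_simps)
    show "0 \<le> e t * M t" using e_pos[of t] by (simp add: M_def)
    have "(\<alpha> + 2) * (- E t) \<le> J t" using J1[OF t] by simp
    then have kJ: "(\<alpha> + 2) * - (e t * E t) \<le> e t * J t"
      using mult_left_mono[of "(\<alpha> + 2) * (- E t)" "J t" "e t"] e_pos[of t] by (simp add: algebra_simps)
    then show "2 * cos \<theta> * (\<alpha> + 2) * - (e t * E t) \<le> 2 * cos \<theta> * (e t * J t)"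
      using mult_left_mono[OF kJ, of "2 * cos \<theta>"] \<theta> by (simp add: algebra_simps)
    have nn: "0 \<le> \<gamma> * (2 * E t + J t)" using J2[OF t] \<gamma> by simp
    have W: "0 \<le> W t" by (simp add: W_def)
    show "0 \<le> e t * (cos \<theta> * W t + \<gamma> * (2 * E t + J t))"
      using nn W \<theta> e_pos[of t] by simp
    assume "0 < - (e t * E t)"
    then have E: "E t < 0" using e_pos[of t] by (simp add: mult_less_0_iff)
    then have "0 \<le> (\<alpha> + 2) * (- E t)" using \<alpha> by (intro mult_nonneg_nonneg) auto
    \<comment> \<open>The lower bound of \<open>J\<close> is nonnegative because \<open>E t < 0\<close>, so multiplying it by \<open>J\<close> preserves the inequality.\<close>
    with \<open>(\<alpha> + 2) * (- E t) \<le> J t\<close> have "(\<alpha> + 2) * (- E t) * J t \<le> J t * J t"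
      by (intro mult_right_mono) auto
    also have "\<dots> \<le> W t * M t" using CS[OF t] by (simp add: power2_eq_square)
    finally have "cos \<theta> * ((\<alpha> + 2) * (- E t) * J t) \<le> cos \<theta> * (W t * M t)"
      using \<theta> by (intro mult_left_mono) auto
    also have "\<dots> \<le> M t * (cos \<theta> * W t + \<gamma> * (2 * E t + J t))"
      using mult_left_mono[OF nn, of "M t"] by (simp add: M_def algebra_simps)
    finally have "(e t)\<^sup>2 * (cos \<theta> * ((\<alpha> + 2) * (- E t) * J t))
        \<le> (e t)\<^sup>2 * (M t * (cos \<theta> * W t + \<gamma> * (2 * E t + J t)))"
      by (intro mult_left_mono) auto
    then show "(\<alpha> + 2) / 2 * (2 * cos \<theta> * (e t * J t)) * - (e t * E t)
        \<le> e t * M t * (e t * (cos \<theta> * W t + \<gamma> * (2 * E t + J t)))"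
      by (simp add: power2_eq_square algebra_simps)
  qed
qed

end

theorem theorem1p1:
  fixes \<theta> \<alpha> \<gamma> :: real
    and u0 :: "real ^ 'n \<Rightarrow> complex"
    and u :: "real \<Rightarrow> real ^ 'n \<Rightarrow> complex"
    and Tmax :: ereal
  assumes "- pi / 2 < \<theta>" and "\<theta> < pi / 2"
    and "\<alpha> > 0" and "\<gamma> > 0"
    and "u0 \<in> H1 \<inter> C0"
    and "is_maximal_solution \<theta> \<alpha> \<gamma> u0 Tmax u"
    and "energy \<alpha> u0 < 0"
  shows "Tmax < \<infinity>"
proof (rule ccontr)
  assume "\<not> Tmax < \<infinity>"
  then have "is_solution \<theta> \<alpha> \<gamma> u0 \<infinity> u"
    using assms(6) by (simp add: is_maximal_solution_def)
  moreover have "0 < cos \<theta>"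
    using assms(1,2) by (intro cos_gt_zero_pi) auto
  ultimately interpret global_solution \<theta> \<alpha> \<gamma> u0 u
    using assms(3,4) by unfold_locales auto
  show False using energy_nonneg assms(7) by simp
qed

end
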